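(* Let $k(i)=\binom{n-1}{i}+\binom{n-1}{n-i}$ for $1\le i\le n-1$ and let $(\theta_1,\dots,\theta_n)\in\mathbb C^n$. Then $(\theta_1,\dots,\theta_n)\in b\mathbf{\Theta}_n$ if and only if $$\left(\frac{\theta_i}{k(i)},\frac{\theta_{n-i}}{k(i)},\theta_n^p\right)\in b\mathbb E\quad\text{for every }1\le i\le n-1$$ and $(\gamma_1\theta_1,\dots,\gamma_{n-1}\theta_{n-1})\in\Gamma_{n-1}$, where $\gamma_i=\frac{n-i}{n}$ for $1\le i\le n-1$.
   Context: $\mathbb D$ is the open unit disc, $\mathbb T$ the unit circle. Fix positive integers $m,p$ with $p$ dividing $m$, and $n\ge2$. Let $s_i$ denote the $i$-th elementary symmetric polynomial; for $d\ge1$, $\Gamma_d=\{(s_1(z),\dots,s_d(z)):z\in\overline{\mathbb D}^d\}$. Define $\theta:\mathbb C^n\to\mathbb C^n$ by $\theta(z)=\big(s_1(z_1^m,\dots,z_n^m),\dots,s_{n-1}(z_1^m,\dots,z_n^m),(z_1\cdots z_n)^{m/p}\big)$, and set $\mathbf{\Theta}_n=\theta(\mathbb D^n)$, $\overline{\mathbf{\Theta}}_n=\theta(\overline{\mathbb D}^n)$. The tetrablock is the domain $\mathbb E=\{(x_1,x_2,x_3)\in\mathbb C^3:1-zx_1-wx_2+zwx_3\ne0\text{ for all }|z|\le1,|w|\le1\}$ and $\overline{\mathbb E}$ is its closure. The distinguished boundaries $b\mathbf{\Theta}_n$ and $b\mathbb E$ are the Shilov boundaries of $\overline{\mathbf{\Theta}}_n$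 and $\overline{\mathbb E}$, i.e. the smallest closed subsets on which every function continuous on the compact set and holomorphic in its interior attains its maximum modulus (known: $b\mathbf{\Theta}_n=\theta(\mathbb T^n)$ and $b\mathbb E=\{x\in\mathbb C^3:x_1=\overline{x_2}x_3,\ |x_2|\le1,\ |x_3|=1\}$). *)

theory Defs
  imports "HOL-Analysis.Analysis"
begin

text \<open>Complex (Frechet) differentiability on \<^term>\<open>UNIV :: (complex ^ 'n) set\<close>: the
  library's \<^const>\<open>has_derivative\<close> is only real linear, so complex homogeneity of the
  derivative is required in addition. Meant for open sets.\<close>

definition holomorphic_vec_on :: "(complex ^ 'n \<Rightarrow> complex) \<Rightarrow> (complex ^ 'n) set \<Rightarrow> bool" where
  "holomorphic_vec_on f U \<longleftrightarrow>
     (\<forall>x\<in>U. \<exists>f'. (f has_derivative f') (at x) \<and> (\<forall>c v. f' (c *s v) = c * f' v))"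

definition max_modulus_set :: "(complex ^ 'n) set \<Rightarrow> (complex ^ 'n) set \<Rightarrow> bool" where
  "max_modulus_set K B \<longleftrightarrow> closed B \<and> B \<subseteq> K \<and>
     (\<forall>f. continuous_on K f \<and> holomorphic_vec_on f (interior K) \<longrightarrow>
        (\<exists>b\<in>B. \<forall>x\<in>K. norm (f x) \<le> norm (f b)))"

text \<open>\<^const>\<open>Least\<close> is taken with respect to inclusion of sets.\<close>

definition shilov_boundary :: "(complex ^ 'n) set \<Rightarrow> (complex ^ 'n) set" where
  "shilov_boundary K = (LEAST B. max_modulus_set K B)"

definition elem_sym :: "nat \<Rightarrow> 'i set \<Rightarrow> ('i \<Rightarrow> complex) \<Rightarrow> complex" where
  "elem_sym i J z = (\<Sum>S | S \<subseteq> J \<and> card S = i. \<Prod>j\<in>S. z j)"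

text \<open>\<open>\<Gamma>\<^sub>d\<close>, the closed symmetrized polydisc. It is needed in dimension
  \<open>CARD('n) - 1\<close>, so its points are functions extensional on \<open>{1..d}\<close> instead of vectors.\<close>

definition symm_polydisc :: "nat \<Rightarrow> (nat \<Rightarrow> complex) set" where
  "symm_polydisc d = (\<lambda>z. \<lambda>i\<in>{1..d}. elem_sym i {1..d} z) ` ({1..d} \<rightarrow>\<^sub>E cball 0 1)"

text \<open>A bijection \<open>idx\<close> from \<open>{1..CARD('n)}\<close> onto \<^typ>\<open>'n\<close> numbers the coordinates: the
  i-th coordinate of \<open>x\<close> is \<open>x $ idx i\<close>. The numbering matters for the values of
  \<open>\<theta>\<close> only, since its components are symmetric in the coordinates of the argument.\<close>

definition theta_map :: "(nat \<Rightarrow> 'n::finite) \<Rightarrow> nat \<Rightarrow> nat \<Rightarrow> complex ^ 'n \<Rightarrow> complex ^ 'n" where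
  "theta_map idx m p z =
     (\<chi> j. let i = the_inv_into {1..CARD('n)} idx j in
        if i = CARD('n) then (\<Prod>l\<in>UNIV. z $ l) ^ (m div p)
        else elem_sym i UNIV (\<lambda>l. (z $ l) ^ m))"

definition closed_Theta :: "(nat \<Rightarrow> 'n::finite) \<Rightarrow> nat \<Rightarrow> nat \<Rightarrow> (complex ^ 'n) set" where
  "closed_Theta idx m p = theta_map idx m p ` {z. \<forall>l. z $ l \<in> cball 0 1}"

definition b_Theta :: "(nat \<Rightarrow> 'n::finite) \<Rightarrow> nat \<Rightarrow> nat \<Rightarrow> (complex ^ 'n) set" where
  "b_Theta idx m p = shilov_boundary (closed_Theta idx m p)"

definition tetrablock :: "(complex ^ 3) set" where
  "tetrablock = {x. \<forall>z w. norm z \<le> 1 \<and> norm w \<le> 1 \<longrightarrow>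
     1 - z * x $ 1 - w * x $ 2 + z * w * x $ 3 \<noteq> 0}"

definition b_tetrablock :: "(complex ^ 3) set" where
  "b_tetrablock = shilov_boundary (closure tetrablock)"

end

theory Submission
  imports Defs "HOL-Complex_Analysis.Conformal_Mappings"
    "HOL-Computational_Algebra.Fundamental_Theorem_Algebra"
begin

text \<open>
  Write \<open>n = CARD('n)\<close> and attach to \<open>y\<close> the monic polynomial
  \<open>P\<^sub>y(x) = x\<^sup>n - y\<^sub>1 x\<^bsup>n-1\<^esup> + \<dots> \<plusminus> y\<^sub>n\<^sup>p\<close>. For \<open>y = \<theta>(z)\<close> its roots are the numbers
  \<open>z\<^sub>j\<^sup>m\<close>; conversely every \<open>y\<close> whose polynomial has the roots \<open>w\<^sub>j\<close> is \<open>\<theta>(z)\<close> for some \<open>z\<close> with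
  \<open>z\<^sub>j\<^sup>m = w\<^sub>j\<close> (lemma \<open>theta_map_lift\<close>). So the image under \<open>\<theta>\<close> of the open polydisc, the closed
  polydisc or the torus consists of the \<open>y\<close> for which all roots of \<open>P\<^sub>y\<close> lie in the open disc, the
  closed disc or the unit circle.

  Given that the distinguished boundaries are \<open>\<theta>(\<T>\<^sup>n)\<close> and
  \<open>{x. x\<^sub>1 = cnj x\<^sub>2 * x\<^sub>3, \<bar>x\<^sub>2\<bar> \<le> 1, \<bar>x\<^sub>3\<bar> = 1}\<close>, and since \<open>k(i)\<close> is the binomial coefficient
  \<open>n choose i\<close>, the tetrablock conditions say that \<open>y\<^sub>i = cnj y\<^bsub>n-i\<^esub> * y\<^sub>n\<^sup>p\<close> with \<open>\<bar>y\<^sub>n\<bar> = 1\<close>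
  (that is, \<open>P\<^sub>y\<close> is self-inversive) and \<open>\<bar>y\<^bsub>n-i\<^esub>\<bar> \<le> n choose i\<close>. The numbers \<open>\<gamma>\<^sub>i y\<^sub>i\<close> are, up to sign,
  the coefficients of \<open>P\<^sub>y'/n\<close>, so the condition on \<open>\<Gamma>\<^bsub>n-1\<^esub>\<close> says that all critical
  points of \<open>P\<^sub>y\<close> lie in the closed disc. The theorem thus says that \<open>P\<^sub>y\<close> has all its roots on the circle
  if and only if it is self-inversive with critical points in the closed disc; the bounds on the coefficients hold
  because \<open>y\<^sub>i\<close> is then a sum of \<open>n choose i\<close> unimodular numbers. One direction is the Gauss--Lucas theorem
  (\<open>pderiv_roots_in_disc\<close>), the other is a theorem of Cohn (\<open>self_inversive_roots_unimodular\<close>).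

  The two distinguished boundaries are computed by the same pair of criteria. A closed set \<open>B\<close>
  carries the maximum modulus of every admissible function if through each point of a dense subset of
  the compact set passes an analytic disc whose boundary lies in \<open>B\<close>
  (\<open>max_modulus_set_by_discs\<close>). For \<open>\<theta>\<close> the discs are images of tuples of Blaschke factors; for the
  tetrablock they are the affine discs \<open>\<zeta> \<mapsto> (a + cnj b * \<zeta>, b + cnj a * \<zeta>, \<zeta>)\<close>. Minimality follows
  from peak functions \<open>h\<^sup>N g\<close> with large \<open>N\<close> (\<open>peak_point_in_max_modulus_set\<close>): the modulus of
  \<open>h\<close> singles out a small subset, on which the fixed function \<open>g\<close> singles out the point.
\<close>

section \<open>Monic polynomials and elementary symmetric functions\<close>

abbreviation monic_with_roots :: "'i set \<Rightarrow> ('i \<Rightarrow> complex) \<Rightarrow> complex poly" where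
  "monic_with_roots J w \<equiv> \<Prod>j\<in>J. [:- w j, 1:]"

lemma poly_monic_with_roots: "poly (monic_with_roots J w) x = (\<Prod>j\<in>J. x - w j)"
  by (simp add: poly_prod)

lemma elem_sym_0: "finite J \<Longrightarrow> elem_sym 0 J w = 1"
proof -
  assume f: "finite J"
  then have "{S. S \<subseteq> J \<and> card S = 0} = {{}}" by (auto dest: finite_subset)
  then show ?thesis by (simp add: elem_sym_def)
qed

lemma elem_sym_card: "finite J \<Longrightarrow> elem_sym (card J) J w = (\<Prod>j\<in>J. w j)"
proof -
  assume f: "finite J"
  then have "{S. S \<subseteq> J \<and> card S = card J} = {J}" by (auto dest: card_subset_eq)
  then show ?thesis by (simp add: elem_sym_def)
qed

lemma elem_sym_cong: "(\<And>j. j \<in> J \<Longrightarrow> v j = w j) \<Longrightarrow> elem_sym i J v = elem_sym i J w"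
  unfolding elem_sym_def by (intro sum.cong prod.cong) auto

lemma norm_elem_sym_le:
  assumes "finite J" "\<And>j. j \<in> J \<Longrightarrow> norm (w j) \<le> 1"
  shows "norm (elem_sym i J w) \<le> card J choose i"
proof -
  have "norm (elem_sym i J w) \<le> (\<Sum>S | S \<subseteq> J \<and> card S = i. 1)"
    unfolding elem_sym_def
  proof (rule sum_norm_le)
    fix S assume "S \<in> {S. S \<subseteq> J \<and> card S = i}"
    then show "norm (\<Prod>j\<in>S. w j) \<le> 1"
      using assms(2) by (auto simp: prod_norm[symmetric] intro!: prod_le_1)
  qed
  then show ?thesis
    using n_subsets[OF assms(1), of i] by simp
qed

text \<open>For unimodular \<open>w\<close> the conjugate of the product over \<open>S\<close> is its inverse, so multiplying it by the
  product over \<open>J\<close> gives the product over \<open>J - S\<close>; complementation turns the subsets of size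
  \<open>card J - i\<close> into those of size \<open>i\<close>.\<close>

lemma elem_sym_unimodular:
  assumes "finite J" "\<And>j. j \<in> J \<Longrightarrow> norm (w j) = 1" "i \<le> card J"
  shows "elem_sym i J w = cnj (elem_sym (card J - i) J w) * (\<Prod>j\<in>J. w j)"
proof -
  have "cnj (elem_sym (card J - i) J w) * (\<Prod>j\<in>J. w j)
      = (\<Sum>S | S \<subseteq> J \<and> card S = card J - i. cnj (\<Prod>j\<in>S. w j) * (\<Prod>j\<in>J. w j))"
    by (simp add: elem_sym_def sum_distrib_right)
  also have "\<dots> = (\<Sum>S | S \<subseteq> J \<and> card S = card J - i. \<Prod>j\<in>J - S. w j)"
  proof (rule sum.cong[OF refl])
    fix S assume "S \<in> {S. S \<subseteq> J \<and> card S = card J - i}"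
    then have S: "S \<subseteq> J" by auto
    have "(\<Prod>j\<in>J. w j) = (\<Prod>j\<in>J - S. w j) * (\<Prod>j\<in>S. w j)"
      by (rule prod.subset_diff[OF S assms(1)])
    moreover have "cnj (\<Prod>j\<in>S. w j) * (\<Prod>j\<in>S. w j) = 1"
    proof -
      have "norm (\<Prod>j\<in>S. w j) = 1"
        using S assms(2) by (auto simp: prod_norm[symmetric] intro!: prod.neutral)
      then show ?thesis
        using complex_norm_square[of "\<Prod>j\<in>S. w j"] by (simp add: mult.commute)
    qed
    ultimately show "cnj (\<Prod>j\<in>S. w j) * (\<Prod>j\<in>J. w j) = (\<Prod>j\<in>J - S. w j)"
      by (simp add: mult.left_commute)
  qed
  also have "\<dots> = elem_sym i J w"
    unfolding elem_sym_def
    by (rule sum.reindex_bij_witness[where i = "\<lambda>S. J - S" and j = "\<lambda>S. J - S"])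
       (use assms in \<open>auto simp: card_Diff_subset finite_subset double_diff\<close>)
  finally show ?thesis ..
qed

text \<open>Vieta: expand the product over the subsets of \<open>J\<close> and collect them by cardinality.\<close>

lemma monic_with_roots_vieta:
  assumes "finite J"
  shows "monic_with_roots J w = (\<Sum>i\<le>card J. monom ((- 1) ^ i * elem_sym i J w) (card J - i))"
proof -
  have "monic_with_roots J w = (\<Prod>j\<in>J. monom 1 1 - [:w j:])"
    by (simp add: monom_altdef)
  also have "\<dots> = (\<Sum>S\<in>Pow J. (- 1) ^ card S * (\<Prod>j\<in>S. [:w j:]) * (\<Prod>j\<in>J - S. monom 1 1))"
    by (rule prod_diff_conv_sum[OF assms])
  also have "\<dots> = (\<Sum>S\<in>Pow J. monom ((- 1) ^ card S * (\<Prod>j\<in>S. w j)) (card J - card S))"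
  proof (rule sum.cong[OF refl])
    fix S assume S: "S \<in> Pow J"
    have a: "(\<Prod>j\<in>S. [:w j:]) = [:\<Prod>j\<in>S. w j:]"
      by (induction S rule: infinite_finite_induct) (auto simp: one_pCons)
    have b: "(\<Prod>j\<in>J - S. monom 1 1) = (monom 1 (card J - card S) :: complex poly)"
      using S assms by (simp add: monom_power card_Diff_subset finite_subset)
    have c: "(- 1) ^ card S = [:(- 1 :: complex) ^ card S:]"
      by (metis minus_pCons one_pCons minus_zero poly_const_pow)
    show "(- 1) ^ card S * (\<Prod>j\<in>S. [:w j:]) * (\<Prod>j\<in>J - S. monom 1 1)
       = monom ((- 1) ^ card S * (\<Prod>j\<in>S. w j)) (card J - card S)"
      unfolding a b c by (simp add: smult_monom)
  qed
  also have "\<dots> = (\<Sum>i\<le>card J. \<Sum>S | S \<in> Pow J \<and> card S = i.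
                     monom ((- 1) ^ card S * (\<Prod>j\<in>S. w j)) (card J - card S))"
    by (rule sum.group[symmetric]) (use assms in \<open>auto simp: card_mono\<close>)
  also have "\<dots> = (\<Sum>i\<le>card J. monom ((- 1) ^ i * elem_sym i J w) (card J - i))"
  proof (rule sum.cong[OF refl])
    fix i
    have "(\<Sum>S | S \<in> Pow J \<and> card S = i. monom ((- 1) ^ card S * (\<Prod>j\<in>S. w j)) (card J - card S))
       = (\<Sum>S | S \<in> Pow J \<and> card S = i. monom ((- 1) ^ i * (\<Prod>j\<in>S. w j)) (card J - i))"
      by (rule sum.cong) auto
    also have "\<dots> = monom ((- 1) ^ i * elem_sym i J w) (card J - i)"
      unfolding elem_sym_def sum_distrib_left by (simp add: monom_sum Pow_def)
    finally show "(\<Sum>S | S \<in> Pow J \<and> card S = i. monom ((- 1) ^ card S * (\<Prod>j\<in>S. w j)) (card J - card S))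
       = monom ((- 1) ^ i * elem_sym i J w) (card J - i)" .
  qed
  finally show ?thesis .
qed

lemma coeff_sum_monom_rev:
  fixes c :: "nat \<Rightarrow> complex"
  assumes "i \<le> n"
  shows "coeff (\<Sum>i\<le>n. monom (c i) (n - i)) (n - i) = c i"
proof -
  have "coeff (\<Sum>i\<le>n. monom (c i) (n - i)) (n - i) = (\<Sum>j\<le>n. if j = i then c i else 0)"
    unfolding coeff_sum by (rule sum.cong) (use assms in auto)
  then show ?thesis using assms by simp
qed

lemma coeff_monic_with_roots:
  assumes "finite J" "i \<le> card J"
  shows "coeff (monic_with_roots J w) (card J - i) = (- 1) ^ i * elem_sym i J w"
  unfolding monic_with_roots_vieta[OF assms(1)] by (rule coeff_sum_monom_rev[OF assms(2)])

lemma degree_monic_with_roots: "finite J \<Longrightarrow> degree (monic_with_roots J w) = card J"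
  by (subst degree_prod_eq_sum_degree) auto

lemma eq_monic_with_roots_iff:
  assumes "finite J" "degree P \<le> card J"
  shows "P = monic_with_roots J w \<longleftrightarrow> (\<forall>i\<le>card J. coeff P (card J - i) = (- 1) ^ i * elem_sym i J w)"
proof
  assume eq: "\<forall>i\<le>card J. coeff P (card J - i) = (- 1) ^ i * elem_sym i J w"
  show "P = monic_with_roots J w"
  proof (rule poly_eqI)
    fix k
    show "coeff P k = coeff (monic_with_roots J w) k"
    proof (cases "k \<le> card J")
      case True
      then show ?thesis
        using eq[rule_format, of "card J - k"] coeff_monic_with_roots[OF assms(1), of "card J - k" w] by simp
    next
      case False
      then show ?thesis
        using assms by (simp add: coeff_eq_0 degree_monic_with_roots)
    qed
  qed
qed (use assms in \<open>simp add: coeff_monic_with_roots\<close>)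

text \<open>The fundamental theorem of algebra, with the roots indexed by an arbitrary set \<open>J\<close> of the right
  size: below \<open>J\<close> is an interval of natural numbers or the index type of the coordinates.\<close>

lemma monic_splits:
  assumes "finite J" "degree P = card J" "lead_coeff P = (1::complex)"
  shows "\<exists>w. P = monic_with_roots J w"
  using assms
proof (induction J arbitrary: P rule: finite_induct)
  case empty
  then show ?case
    by (auto elim!: degree_eq_zeroE simp: one_pCons)
next
  case (insert a J)
  then have "\<not> constant (poly P)"
    by (simp add: constant_degree)
  then obtain r where "poly P r = 0"
    using Fundamental_Theorem_Algebra.fundamental_theorem_of_algebra by blast
  then obtain Q where Q: "P = [:- r, 1:] * Q"
    by (auto simp: poly_eq_0_iff_dvd)
  have "Q \<noteq> 0" using insert.prems Q by auto
  then have "degree P = Suc (degree Q)" 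
    unfolding Q by (subst degree_mult_eq) auto
  moreover have "lead_coeff Q = 1"
    using insert.prems(2) unfolding Q lead_coeff_mult by simp
  ultimately obtain w where w: "Q = monic_with_roots J w"
    using insert by auto
  have "P = monic_with_roots (insert a J) (w(a := r))"
  proof -
    have "monic_with_roots J (w(a := r)) = monic_with_roots J w"
      by (rule prod.cong) (use insert.hyps in auto)
    then show ?thesis
      using insert.hyps by (simp only: Q w prod.insert) simp
  qed
  then show ?case by blast
qed

text \<open>Frees membership in the symmetrized polydisc from extensional functions: only the values on
  \<open>{1..d}\<close> matter on either side.\<close>

lemma restrict_in_symm_polydisc_iff:
  "(\<lambda>i\<in>{1..d}. s i) \<in> symm_polydisc d \<longleftrightarrow>
     (\<exists>v. (\<forall>j\<in>{1..d}. norm (v j) \<le> 1) \<and> (\<forall>i\<in>{1..d}. s i = elem_sym i {1..d} v))"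
proof
  assume "(\<lambda>i\<in>{1..d}. s i) \<in> symm_polydisc d"
  then obtain v where v: "v \<in> {1..d} \<rightarrow>\<^sub>E cball 0 1"
    and eq: "(\<lambda>i\<in>{1..d}. s i) = (\<lambda>i\<in>{1..d}. elem_sym i {1..d} v)"
    unfolding symm_polydisc_def by blast
  have "s i = elem_sym i {1..d} v" if "i \<in> {1..d}" for i
    using fun_cong[OF eq, of i] that by simp
  moreover have "norm (v j) \<le> 1" if "j \<in> {1..d}" for j
    using PiE_mem[OF v that] by simp
  ultimately show "\<exists>v. (\<forall>j\<in>{1..d}. norm (v j) \<le> 1) \<and> (\<forall>i\<in>{1..d}. s i = elem_sym i {1..d} v)"
    by blast
next
  assume "\<exists>v. (\<forall>j\<in>{1..d}. norm (v j) \<le> 1) \<and> (\<forall>i\<in>{1..d}. s i = elem_sym i {1..d} v)"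
  then obtain v where v: "\<And>j. j \<in> {1..d} \<Longrightarrow> norm (v j) \<le> 1" "\<And>i. i \<in> {1..d} \<Longrightarrow> s i = elem_sym i {1..d} v"
    by blast
  have "(\<lambda>i\<in>{1..d}. s i) = (\<lambda>i\<in>{1..d}. elem_sym i {1..d} (restrict v {1..d}))"
  proof (rule restrict_ext)
    fix i assume "i \<in> {1..d}"
    then show "s i = elem_sym i {1..d} (restrict v {1..d})"
      using elem_sym_cong[of "{1..d}" "restrict v {1..d}" v i] v(2) by simp
  qed
  moreover have "restrict v {1..d} \<in> {1..d} \<rightarrow>\<^sub>E cball 0 1" using v(1) by auto
  ultimately show "(\<lambda>i\<in>{1..d}. s i) \<in> symm_polydisc d"
    unfolding symm_polydisc_def by (rule image_eqI)
qed

section \<open>Critical points and roots on the unit circle\<close>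

text \<open>This identity controls the Blaschke factor \<open>(z - a) / (1 - cnj a * z)\<close>: for \<open>\<bar>a\<bar> < 1\<close> it compares
  the factor with 1 according to the position of \<open>z\<close> relative to the unit circle.\<close>

lemma blaschke_identity:
  "(norm (1 - cnj a * z))\<^sup>2 - (norm (z - a))\<^sup>2 = (1 - (norm z)\<^sup>2) * (1 - (norm a)\<^sup>2)"
  by (simp only: cmod_power2) (simp add: power2_eq_square algebra_simps)

text \<open>The Gauss--Lucas theorem for the unit disc. If \<open>\<bar>x\<bar> > 1\<close>, then every \<open>x / (x - w j)\<close> has positive
  real part, so the logarithmic derivative \<open>\<Sum>j. 1 / (x - w j)\<close> cannot vanish at \<open>x\<close>.\<close>

lemma pderiv_roots_in_disc:
  assumes "finite J" "J \<noteq> {}" "\<And>j. j \<in> J \<Longrightarrow> norm (w j) \<le> 1"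
    and "poly (pderiv (monic_with_roots J w)) x = 0"
  shows "norm x \<le> 1"
proof (rule ccontr)
  assume x: "\<not> norm x \<le> 1"
  have ne: "x - w j \<noteq> 0" if "j \<in> J" for j
    using assms(3)[OF that] x by auto
  have "poly (pderiv (monic_with_roots J w)) x = (\<Sum>j\<in>J. \<Prod>i\<in>J - {j}. x - w i)"
    by (simp add: pderiv_prod poly_sum poly_prod pderiv_pCons)
  also have "\<dots> = (\<Sum>j\<in>J. (\<Prod>i\<in>J. x - w i) * inverse (x - w j))"
    by (rule sum.cong) (use assms(1) ne in \<open>auto simp: prod.remove field_simps\<close>)
  also have "\<dots> = (\<Prod>i\<in>J. x - w i) * (\<Sum>j\<in>J. inverse (x - w j))"
    by (simp add: sum_distrib_left)
  finally have "(\<Sum>j\<in>J. inverse (x - w j)) = 0"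
    using assms(1,4) ne by simp
  then have "(\<Sum>j\<in>J. Re (x * inverse (x - w j))) = 0"
    by (metis Re_sum sum_distrib_left mult_zero_right zero_complex.simps(1))
  moreover have "Re (x * inverse (x - w j)) > 0" if "j \<in> J" for j
  proof -
    \<comment> \<open>The sign of the real part of \<open>x / (x - w j)\<close> is that of \<open>x cnj (x - w j)\<close>.\<close>
    have "Re (cnj x * w j) < (norm x)\<^sup>2"
    proof -
      have "Re (cnj x * w j) \<le> norm (cnj x * w j)" by (rule complex_Re_le_cmod)
      also have "\<dots> \<le> norm x"
        using assms(3)[OF that] by (simp add: norm_mult mult_left_le)
      also have "\<dots> < (norm x)\<^sup>2" using x by (intro power_strict_increasing[of 1 2 "norm x", simplified]) auto
      finally show ?thesis .
    qed
    then have "Re (x * cnj (x - w j)) > 0"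
      unfolding cmod_power2 by (simp add: power2_eq_square algebra_simps)
    moreover have "x * inverse (x - w j) = (x * cnj (x - w j)) / (of_real ((norm (x - w j))\<^sup>2))"
      using complex_div_cnj[of x "x - w j"] by (simp add: divide_inverse)
    ultimately show ?thesis
      using ne[OF that] by (simp only: Re_divide_of_real) simp
  qed
  ultimately show False
    using assms(1,2) by (metis less_irrefl sum_pos)
qed

text \<open>A theorem of Cohn. Self-inversiveness gives
  \<open>n P(x) - x P'(x) = \<epsilon> x\<^bsup>n-1\<^esup> cnj (P'(1 / cnj x))\<close>. When all roots of \<open>P'\<close> are in the closed disc,
  comparing \<open>P'\<close> and its reversed conjugate factor by factor shows that the modulus of the right-hand
  side is at most \<open>\<bar>P'(x)\<bar>\<close> for \<open>\<bar>x\<bar> > 1\<close>. A root \<open>x\<close> of \<open>P\<close> outside the disc would give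
  \<open>\<bar>x\<bar> \<bar>P'(x)\<bar> \<le> \<bar>P'(x)\<bar>\<close>, hence \<open>P'(x) = 0\<close>, contrary to the assumption on \<open>P'\<close>. As
  \<open>x \<mapsto> 1 / cnj x\<close> permutes the roots of \<open>P\<close>, there are none inside the disc either.\<close>

lemma self_inversive_roots_unimodular:
  fixes P :: "complex poly"
  assumes deg: "degree P = n" and n: "n > 0" and eps: "norm \<epsilon> = 1"
    and self: "\<And>k. k \<le> n \<Longrightarrow> coeff P k = \<epsilon> * cnj (coeff P (n - k))"
    and crit: "\<And>x. poly (pderiv P) x = 0 \<Longrightarrow> norm x \<le> 1"
    and root: "poly P x = 0"
  shows "norm x = 1"
proof -
  have reflection: "poly P x = \<epsilon> * x ^ n * cnj (poly P (1 / cnj x))" if "x \<noteq> 0" for x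
  proof -
    have "poly P x = (\<Sum>k\<le>n. \<epsilon> * cnj (coeff P (n - k)) * x ^ k)"
      unfolding poly_altdef deg by (rule sum.cong) (auto simp: self[symmetric])
    also have "\<dots> = (\<Sum>k\<le>n. \<epsilon> * cnj (coeff P k) * x ^ (n - k))"
      by (rule sum.reindex_bij_witness[where i = "\<lambda>k. n - k" and j = "\<lambda>k. n - k"]) auto
    also have "\<dots> = \<epsilon> * x ^ n * cnj (poly P (1 / cnj x))"
      unfolding poly_altdef deg cnj_sum sum_distrib_left
      by (rule sum.cong) (use that in \<open>auto simp: power_diff field_simps\<close>)
    finally show ?thesis .
  qed
  have outside: False if x: "poly P x = 0" "norm x > 1" for x
  proof -
    have x0: "x \<noteq> 0" using x(2) by auto
    let ?D = "pderiv P"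
    have D: "degree ?D = n - 1" by (simp add: degree_pderiv deg)
    have "?D \<noteq> 0" using deg n by (simp add: pderiv_eq_0_iff)
    then have lc: "lead_coeff ?D \<noteq> 0" by simp
    have "\<exists>u. smult (inverse (lead_coeff ?D)) ?D = monic_with_roots {..<n - 1} u"
      using lc D by (intro monic_splits) (simp_all only: degree_smult_eq coeff_smult, auto)
    then obtain u where "smult (inverse (lead_coeff ?D)) ?D = monic_with_roots {..<n - 1} u" ..
    then have u: "?D = smult (lead_coeff ?D) (monic_with_roots {..<n - 1} u)"
      using lc by (metis right_inverse smult_1_left smult_smult)
    then have uval: "poly ?D y = lead_coeff ?D * (\<Prod>j<n - 1. y - u j)" for y
      by (metis poly_monic_with_roots poly_smult)
    have u1: "norm (u j) \<le> 1" if "j < n - 1" for j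
      using that by (intro crit) (auto simp: uval)
    have deriv: "n * poly P x - x * poly ?D x = \<epsilon> * x ^ (n - 1) * cnj (poly ?D (1 / cnj x))"
    proof -
      have Dy: "y * poly ?D y = (\<Sum>k\<le>n. of_nat k * coeff P k * y ^ k)" for y
      proof -
        have "y * poly ?D y = (\<Sum>k\<le>n - 1. of_nat (Suc k) * coeff P (Suc k) * y ^ Suc k)"
          unfolding poly_altdef D sum_distrib_left
          by (rule sum.cong) (auto simp: coeff_pderiv)
        also have "\<dots> = (\<Sum>k<n. of_nat (Suc k) * coeff P (Suc k) * y ^ Suc k)"
          using n by (intro sum.cong) auto
        also have "\<dots> = (\<Sum>k\<le>n. of_nat k * coeff P k * y ^ k)"
          by (subst sum.atMost_shift) simp
        finally show ?thesis .
      qed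
      have "n * poly P x - x * poly ?D x = (\<Sum>k\<le>n. of_nat (n - k) * coeff P k * x ^ k)"
        unfolding Dy unfolding poly_altdef deg sum_distrib_left sum_subtractf[symmetric]
        by (rule sum.cong) (auto simp: of_nat_diff algebra_simps)
      also have "\<dots> = (\<Sum>k\<le>n. of_nat (n - k) * (\<epsilon> * cnj (coeff P (n - k))) * x ^ k)"
        by (rule sum.cong) (auto simp: self[symmetric])
      also have "\<dots> = (\<Sum>k\<le>n. of_nat k * (\<epsilon> * cnj (coeff P k)) * x ^ (n - k))"
        by (rule sum.reindex_bij_witness[where i = "\<lambda>k. n - k" and j = "\<lambda>k. n - k"]) auto
      also have "\<dots> = \<epsilon> * x ^ n * cnj (1 / cnj x * poly ?D (1 / cnj x))"
        unfolding Dy cnj_sum sum_distrib_left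
        by (rule sum.cong) (use x0 in \<open>auto simp: power_diff field_simps\<close>)
      also have "\<dots> = \<epsilon> * x ^ (n - 1) * cnj (poly ?D (1 / cnj x))"
        using n x0 by (simp add: power_eq_if)
      finally show ?thesis .
    qed
    have "norm (x ^ (n - 1) * cnj (poly ?D (1 / cnj x))) \<le> norm (poly ?D x)"
    proof -
      have "norm (x ^ (n - 1) * cnj (poly ?D (1 / cnj x)))
          = norm (lead_coeff ?D) * (\<Prod>j<n - 1. norm (1 - cnj (u j) * x))"
      proof -
        have "norm (x ^ (n - 1) * (\<Prod>j<n - 1. 1 / x - cnj (u j)))
            = (\<Prod>j<n - 1. norm x) * (\<Prod>j<n - 1. norm (1 / x - cnj (u j)))"
          by (simp add: norm_mult norm_power prod_norm)
        also have "\<dots> = (\<Prod>j<n - 1. norm (1 - cnj (u j) * x))"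
          unfolding prod.distrib[symmetric] norm_mult[symmetric]
          by (rule prod.cong) (use x0 in \<open>auto simp: algebra_simps\<close>)
        finally show ?thesis
          unfolding uval by (simp add: norm_mult)
      qed
      also have "\<dots> \<le> norm (lead_coeff ?D) * (\<Prod>j<n - 1. norm (x - u j))"
      proof (intro mult_left_mono prod_mono conjI)
        fix j assume "j \<in> {..<n - 1}"
        then have "(1 - (norm x)\<^sup>2) * (1 - (norm (u j))\<^sup>2) \<le> 0"
          using u1[of j] x(2) by (intro mult_nonpos_nonneg) (auto simp: power_le_one)
        then have "(norm (1 - cnj (u j) * x))\<^sup>2 \<le> (norm (x - u j))\<^sup>2"
          using blaschke_identity[of "u j" x] by linarith
        then show "norm (1 - cnj (u j) * x) \<le> norm (x - u j)"
          by (rule power2_le_imp_le) simp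
      qed auto
      also have "\<dots> = norm (poly ?D x)"
        by (simp add: uval norm_mult prod_norm)
      finally show ?thesis .
    qed
    then have "norm x * norm (poly ?D x) \<le> norm (poly ?D x)"
    proof -
      have "norm x * norm (poly ?D x) = norm (n * poly P x - x * poly ?D x)"
        by (simp add: x(1) norm_mult)
      also have "\<dots> = norm (x ^ (n - 1) * cnj (poly ?D (1 / cnj x)))"
        unfolding deriv by (simp add: norm_mult eps)
      finally show ?thesis
        using \<open>norm (x ^ (n - 1) * cnj (poly ?D (1 / cnj x))) \<le> norm (poly ?D x)\<close> by simp
    qed
    moreover have "norm (poly ?D x) > 0"
      using crit[of x] x(2) by auto
    ultimately show False
      using x(2) by (simp add: mult_le_cancel_right2)
  qed
  have "coeff P 0 \<noteq> 0"
  proof -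
    have "coeff P n \<noteq> 0" using deg n by (metis degree_0 leading_coeff_0_iff less_irrefl)
    moreover have "\<epsilon> \<noteq> 0" using eps by auto
    ultimately show ?thesis using self[of 0] by simp
  qed
  then have x0: "x \<noteq> 0" using root by (auto simp: poly_0_coeff_0)
  have "poly P (1 / cnj x) = 0"
    using reflection[OF x0] root x0 eps by auto
  then have "norm (1 / cnj x) \<le> 1" using outside not_le by blast
  then have "1 \<le> norm x" using x0 by (simp add: norm_divide divide_le_eq_1)
  moreover have "norm x \<le> 1" using outside[OF root] not_le by blast
  ultimately show ?thesis
    by simp
qed

section \<open>Holomorphic functions of several variables\<close>

lemma holomorphic_vec_on_const: "holomorphic_vec_on (\<lambda>x. c) U"
  unfolding holomorphic_vec_on_def by (auto intro!: exI[of _ "\<lambda>_. 0"])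

lemma holomorphic_vec_on_component: "holomorphic_vec_on (\<lambda>x :: complex ^ 'n. x $ i) U"
proof -
  have "((\<lambda>x. x $ i) has_derivative (\<lambda>x. x $ i)) (at x)" for x :: "complex ^ 'n"
    by (intro bounded_linear_imp_has_derivative bounded_linear_vec_nth)
  then show ?thesis
    unfolding holomorphic_vec_on_def by (intro ballI exI[of _ "\<lambda>x. x $ i"]) auto
qed

lemma holomorphic_vec_on_add:
  assumes "holomorphic_vec_on f U" "holomorphic_vec_on g U"
  shows "holomorphic_vec_on (\<lambda>x. f x + g x) U"
  unfolding holomorphic_vec_on_def
proof
  fix x assume "x \<in> U"
  with assms obtain f' g' where
    "(f has_derivative f') (at x)" "\<forall>c v. f' (c *s v) = c * f' v"
    "(g has_derivative g') (at x)" "\<forall>c v. g' (c *s v) = c * g' v"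
    unfolding holomorphic_vec_on_def by meson
  then show "\<exists>h'. ((\<lambda>x. f x + g x) has_derivative h') (at x) \<and> (\<forall>c v. h' (c *s v) = c * h' v)"
    by (intro exI[of _ "\<lambda>v. f' v + g' v"]) (auto intro: has_derivative_add simp: algebra_simps)
qed

lemma holomorphic_vec_on_mult:
  assumes "holomorphic_vec_on f U" "holomorphic_vec_on g U"
  shows "holomorphic_vec_on (\<lambda>x. f x * g x) U"
  unfolding holomorphic_vec_on_def
proof
  fix x assume "x \<in> U"
  with assms obtain f' g' where
    "(f has_derivative f') (at x)" "\<forall>c v. f' (c *s v) = c * f' v"
    "(g has_derivative g') (at x)" "\<forall>c v. g' (c *s v) = c * g' v"
    unfolding holomorphic_vec_on_def by meson
  then show "\<exists>h'. ((\<lambda>x. f x * g x) has_derivative h') (at x) \<and> (\<forall>c v. h' (c *s v) = c * h' v)"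
    by (intro exI[of _ "\<lambda>v. f x * g' v + f' v * g x"])
       (auto intro!: has_derivative_mult simp: algebra_simps)
qed

lemma holomorphic_vec_on_diff:
  assumes "holomorphic_vec_on f U" "holomorphic_vec_on g U"
  shows "holomorphic_vec_on (\<lambda>x. f x - g x) U"
  using holomorphic_vec_on_add[OF assms(1) holomorphic_vec_on_mult[OF holomorphic_vec_on_const[of "- 1"] assms(2)]]
  by simp

lemma holomorphic_vec_on_power:
  "holomorphic_vec_on f U \<Longrightarrow> holomorphic_vec_on (\<lambda>x. f x ^ n) U"
  by (induction n) (auto intro: holomorphic_vec_on_mult holomorphic_vec_on_const)

lemma holomorphic_vec_on_sum:
  "(\<And>i. i \<in> I \<Longrightarrow> holomorphic_vec_on (f i) U) \<Longrightarrow> holomorphic_vec_on (\<lambda>x. \<Sum>i\<in>I. f i x) U"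
  by (induction I rule: infinite_finite_induct)
     (auto intro: holomorphic_vec_on_add holomorphic_vec_on_const)

lemma holomorphic_vec_on_prod:
  "(\<And>i. i \<in> I \<Longrightarrow> holomorphic_vec_on (f i) U) \<Longrightarrow> holomorphic_vec_on (\<lambda>x. \<Prod>i\<in>I. f i x) U"
  by (induction I rule: infinite_finite_induct)
     (auto intro: holomorphic_vec_on_mult holomorphic_vec_on_const)

lemmas holomorphic_vec_intros =
  holomorphic_vec_on_const holomorphic_vec_on_component holomorphic_vec_on_add
  holomorphic_vec_on_mult holomorphic_vec_on_diff holomorphic_vec_on_power
  holomorphic_vec_on_sum holomorphic_vec_on_prod

lemma has_derivative_curve:
  fixes \<phi> :: "complex \<Rightarrow> complex ^ 'n"
  assumes "\<And>i. ((\<lambda>\<zeta>. \<phi> \<zeta> $ i) has_field_derivative v $ i) (at \<zeta>)"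
  shows "(\<phi> has_derivative (\<lambda>c. c *s v)) (at \<zeta>)"
proof -
  have ax: "bounded_linear (\<lambda>c :: complex. axis i c :: complex ^ 'n)" for i
    by (rule linear_conv_bounded_linear[THEN iffD1], rule linearI) (auto simp: vec_eq_iff axis_def)
  have "((\<lambda>\<zeta>. \<Sum>i\<in>UNIV. axis i (\<phi> \<zeta> $ i) :: complex ^ 'n) has_derivative
      (\<lambda>c. \<Sum>i\<in>UNIV. axis i (v $ i * c))) (at \<zeta>)"
    by (intro has_derivative_sum bounded_linear.has_derivative[OF ax])
       (use assms in \<open>simp add: has_field_derivative_def\<close>)
  moreover have "(\<Sum>i\<in>UNIV. axis i (x $ i)) = x" for x :: "complex ^ 'n"
    by (simp add: vec_eq_iff axis_def)
  moreover have "(\<Sum>i\<in>UNIV. axis i (v $ i * c)) = c *s v" for c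
    by (simp add: vec_eq_iff axis_def)
  ultimately show ?thesis by simp
qed

text \<open>Complex homogeneity of the derivative of \<open>f\<close> is what turns the chain rule, which is a statement
  about real derivatives, into complex differentiability of the composition.\<close>

lemma holomorphic_on_along_curve:
  fixes \<phi> :: "complex \<Rightarrow> complex ^ 'n"
  assumes f: "holomorphic_vec_on f V"
    and \<phi>: "\<And>i. (\<lambda>\<zeta>. \<phi> \<zeta> $ i) holomorphic_on U" "\<phi> ` U \<subseteq> V" and "open U"
  shows "(\<lambda>\<zeta>. f (\<phi> \<zeta>)) holomorphic_on U"
proof -
  have "(\<lambda>\<zeta>. f (\<phi> \<zeta>)) field_differentiable (at \<zeta>)" if \<zeta>: "\<zeta> \<in> U" for \<zeta>
  proof -
    have "\<exists>d. ((\<lambda>\<zeta>. \<phi> \<zeta> $ i) has_field_derivative d) (at \<zeta>)" for i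
      using \<phi>(1) \<zeta> \<open>open U\<close> by (meson field_differentiable_def holomorphic_on_imp_differentiable_at)
    then obtain d where d: "\<And>i. ((\<lambda>\<zeta>. \<phi> \<zeta> $ i) has_field_derivative d i) (at \<zeta>)"
      by metis
    define v where "v = (\<chi> i. d i)"
    have \<phi>': "(\<phi> has_derivative (\<lambda>c. c *s v)) (at \<zeta>)"
      by (rule has_derivative_curve) (simp add: v_def d)
    obtain f' where f': "(f has_derivative f') (at (\<phi> \<zeta>))" "\<And>c v. f' (c *s v) = c * f' v"
      using f \<phi>(2) \<zeta> unfolding holomorphic_vec_on_def by blast
    have "((\<lambda>\<zeta>. f (\<phi> \<zeta>)) has_derivative (\<lambda>c. f' (c *s v))) (at \<zeta>)"
      using has_derivative_compose[OF \<phi>' f'(1)] by simp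
    then have "((\<lambda>\<zeta>. f (\<phi> \<zeta>)) has_field_derivative f' v) (at \<zeta>)"
      by (simp add: f'(2) has_field_derivative_def mult_commute_abs)
    then show ?thesis
      unfolding field_differentiable_def by blast
  qed
  then show ?thesis
    by (simp add: holomorphic_on_def field_differentiable_at_within)
qed

lemma continuous_on_cartI:
  fixes f :: "'a::topological_space \<Rightarrow> 'b::topological_space ^ 'n"
  assumes "\<And>i. continuous_on S (\<lambda>x. f x $ i)"
  shows "continuous_on S f"
  using continuous_on_vec_lambda[of S "\<lambda>i x. f x $ i", OF assms] by simp

lemma bounded_componentwise_cart:
  assumes "\<And>x i. x \<in> S \<Longrightarrow> norm (x $ i) \<le> c"
  shows "bounded (S :: (complex ^ 'n) set)"
proof -
  have "norm x \<le> CARD('n) * c" if "x \<in> S" for x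
  proof -
    have "norm x \<le> (\<Sum>i\<in>UNIV. norm (x $ i))"
      unfolding norm_vec_def by (rule L2_set_le_sum) auto
    also have "\<dots> \<le> (\<Sum>i\<in>(UNIV :: 'n set). c)"
      by (rule sum_mono) (use assms that in auto)
    finally show ?thesis by simp
  qed
  then show ?thesis unfolding bounded_iff by blast
qed

lemma finite_vec_components:
  assumes "finite A"
  shows "finite {v :: complex ^ 'n. \<forall>l. v $ l \<in> A}"
proof (rule finite_subset)
  show "{v :: complex ^ 'n. \<forall>l. v $ l \<in> A} \<subseteq> vec_lambda ` (UNIV \<rightarrow>\<^sub>E A)"
  proof
    fix v :: "complex ^ 'n" assume "v \<in> {v. \<forall>l. v $ l \<in> A}"
    then have "vec_nth v \<in> UNIV \<rightarrow>\<^sub>E A" by auto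
    then show "v \<in> vec_lambda ` (UNIV \<rightarrow>\<^sub>E A)" by (metis image_eqI vec_nth_inverse)
  qed
  show "finite (vec_lambda ` (UNIV \<rightarrow>\<^sub>E A) :: (complex ^ 'n) set)"
    using assms by (intro finite_imageI finite_PiE) auto
qed

section \<open>Maximum modulus sets\<close>

text \<open>On each disc the one-variable maximum modulus principle bounds \<open>f\<close> by its maximum over \<open>B\<close>;
  density of \<open>X\<close> and continuity of \<open>f\<close> extend the bound to \<open>K\<close>.\<close>

lemma max_modulus_set_by_discs:
  fixes K :: "(complex ^ 'n) set"
  assumes K: "compact K" "K \<noteq> {}" and B: "closed B" "B \<subseteq> K" and X: "X \<subseteq> K" "K \<subseteq> closure X"
    and disc: "\<And>x. x \<in> X \<Longrightarrow> \<exists>\<phi>. continuous_on (cball 0 1) \<phi> \<and>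
        (\<forall>i. (\<lambda>\<zeta>. \<phi> \<zeta> $ i) holomorphic_on ball 0 1) \<and>
        \<phi> ` ball 0 1 \<subseteq> interior K \<and> \<phi> ` sphere 0 1 \<subseteq> B \<and> x \<in> \<phi> ` ball 0 1"
  shows "max_modulus_set K B"
proof -
  have "B \<noteq> {}"
  proof -
    obtain x where "x \<in> X" using K(2) X by fastforce
    then obtain \<phi> :: "complex \<Rightarrow> complex ^ 'n" where "\<phi> ` sphere 0 1 \<subseteq> B"
      using disc[OF \<open>x \<in> X\<close>] by (elim exE conjE)
    moreover have "(1::complex) \<in> sphere 0 1" by simp
    ultimately show ?thesis by blast
  qed
  have "compact B"
    using K(1) B by (metis compact_Int_closed inf.absorb_iff2)
  have attained: "\<exists>b\<in>B. \<forall>x\<in>K. norm (f x) \<le> norm (f b)"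
    if cf: "continuous_on K f" and hf: "holomorphic_vec_on f (interior K)" for f
  proof -
    obtain b where b: "b \<in> B" "\<And>y. y \<in> B \<Longrightarrow> norm (f y) \<le> norm (f b)"
    proof -
      have "continuous_on B (\<lambda>x. norm (f x))"
        using cf B(2) by (intro continuous_on_norm) (rule continuous_on_subset)
      from continuous_attains_sup[OF \<open>compact B\<close> \<open>B \<noteq> {}\<close> this] that show ?thesis by blast
    qed
    have X_le: "norm (f x) \<le> norm (f b)" if x: "x \<in> X" for x
    proof -
      from disc[OF x] obtain \<phi> where \<phi>: "continuous_on (cball 0 1) \<phi>"
        "\<forall>i. (\<lambda>\<zeta>. \<phi> \<zeta> $ i) holomorphic_on ball 0 1" "\<phi> ` ball 0 1 \<subseteq> interior K"
        "\<phi> ` sphere 0 1 \<subseteq> B" "x \<in> \<phi> ` ball 0 1"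
        by (elim exE conjE)
      then obtain \<zeta> where \<zeta>: "\<zeta> \<in> ball 0 1" "x = \<phi> \<zeta>" by blast
      have "cball 0 1 = ball 0 1 \<union> sphere (0::complex) 1" by auto
      then have "\<phi> ` cball 0 1 \<subseteq> K"
        using \<phi>(3,4) B(2) interior_subset[of K] by (simp only: image_Un) blast
      then have cont: "continuous_on (cball 0 1) (\<lambda>\<zeta>. f (\<phi> \<zeta>))"
        using continuous_on_compose2[OF cf \<phi>(1)] by blast
      have hol: "(\<lambda>\<zeta>. f (\<phi> \<zeta>)) holomorphic_on ball 0 1"
        by (rule holomorphic_on_along_curve[OF hf \<phi>(2)[rule_format] \<phi>(3)]) auto
      have "norm (f (\<phi> z)) \<le> norm (f b)" if "norm z = 1" for z
        using \<phi>(4) that by (intro b(2)) auto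
      then have bd: "norm (f (\<phi> z)) \<le> norm (f b)" if "z \<in> frontier (cball 0 1)" for z
        using that by simp
      have "norm (f (\<phi> \<zeta>)) \<le> norm (f b)"
        by (rule maximum_modulus_frontier[where S = "cball 0 1" and f = "\<lambda>\<zeta>. f (\<phi> \<zeta>)", OF _ _ _ bd])
           (use cont hol \<zeta> in auto)
      with \<zeta> show ?thesis by simp
    qed
    have "norm (f x) \<le> norm (f b)" if x: "x \<in> K" for x
    proof -
      obtain u where u: "\<And>k. u k \<in> X" "u \<longlonglongrightarrow> x"
        using x X(2) closure_sequential by (metis subsetD)
      have "u k \<in> K" for k using u(1) X(1) by blast
      then have "(\<lambda>k. f (u k)) \<longlonglongrightarrow> f x"
        using continuous_on_tendsto_compose[OF cf u(2) x] by simp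
      then show ?thesis
        by (intro LIMSEQ_le_const2[OF tendsto_norm]) (use X_le u(1) in auto)
    qed
    with b(1) show ?thesis by blast
  qed
  show ?thesis
    unfolding max_modulus_set_def
  proof (rule conjI[OF B(1) conjI[OF B(2)]], rule allI, rule impI)
    fix f
    assume "continuous_on K f \<and> holomorphic_vec_on f (interior K)"
    then show "\<exists>b\<in>B. \<forall>x\<in>K. norm (f x) \<le> norm (f b)"
      by (intro attained[of f]) simp_all
  qed
qed

text \<open>The function \<open>h\<^sup>N L\<close> attains its maximum modulus at some \<open>c\<^sub>N \<in> C\<close>, where it is at least its value
  \<open>\<bar>L b\<bar> > 0\<close> at \<open>b\<close>. At a limit point \<open>a \<in> C\<close> of the \<open>c\<^sub>N\<close> this forces \<open>\<bar>h a\<bar> = 1\<close>, since otherwise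
  \<open>\<bar>h(c\<^sub>N)\<bar>\<^sup>N\<close> would tend to 0 along the subsequence, and \<open>\<bar>L b\<bar> \<le> \<bar>L a\<bar>\<close>; so \<open>a = b\<close>.
  Splitting the peak function into two factors allows \<open>h\<close> to have modulus 1 on a larger set, as long as
  \<open>L\<close> separates \<open>b\<close> from the rest of that set.\<close>

lemma peak_point_in_max_modulus_set:
  fixes K :: "(complex ^ 'n) set"
  assumes K: "compact K" and C: "max_modulus_set K C" and b: "b \<in> K"
    and h: "continuous_on K h" "holomorphic_vec_on h (interior K)"
    and L: "continuous_on K L" "holomorphic_vec_on L (interior K)"
    and h1: "\<And>x. x \<in> K \<Longrightarrow> norm (h x) \<le> 1" and hb: "norm (h b) = 1" and Lb: "L b \<noteq> 0"
    and uniq: "\<And>x. x \<in> K \<Longrightarrow> norm (h x) = 1 \<Longrightarrow> norm (L b) \<le> norm (L x) \<Longrightarrow> x = b"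
  shows "b \<in> C"
proof -
  have CK: "closed C" "C \<subseteq> K" using C unfolding max_modulus_set_def by blast+
  have "compact C" using K CK by (metis compact_Int_closed inf.absorb_iff2)
  have "\<exists>c\<in>C. norm (L b) \<le> norm (h c) ^ N * norm (L c)" for N
  proof -
    let ?f = "\<lambda>x. h x ^ N * L x"
    have "continuous_on K ?f" "holomorphic_vec_on ?f (interior K)"
      using h L by (auto intro!: continuous_intros holomorphic_vec_intros)
    then obtain c where "c \<in> C" "\<forall>x\<in>K. norm (?f x) \<le> norm (?f c)"
      using C unfolding max_modulus_set_def by blast
    then show ?thesis
      using b hb by (intro bexI[of _ c]) (auto simp: norm_mult norm_power)
  qed
  then obtain c where c: "\<And>N. c N \<in> C" "\<And>N. norm (L b) \<le> norm (h (c N)) ^ N * norm (L (c N))"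
    by metis
  obtain a r where a: "a \<in> C" and r: "strict_mono r" and lim: "(c \<circ> r) \<longlonglongrightarrow> a"
    using \<open>compact C\<close> c(1) unfolding compact_def by metis
  have aK: "a \<in> K" and cK: "\<And>N. c N \<in> K" using a c(1) CK(2) by auto
  have limh: "(\<lambda>k. h (c (r k))) \<longlonglongrightarrow> h a"
    using continuous_on_tendsto_compose[OF h(1) lim aK] cK by (auto simp: o_def)
  have limL: "(\<lambda>k. L (c (r k))) \<longlonglongrightarrow> L a"
    using continuous_on_tendsto_compose[OF L(1) lim aK] cK by (auto simp: o_def)
  have "norm (L b) \<le> norm (L (c N))" for N
  proof -
    have "norm (h (c N)) ^ N * norm (L (c N)) \<le> 1 * norm (L (c N))"
      by (intro mult_right_mono power_le_one) (auto simp: h1 cK)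
    with c(2)[of N] show ?thesis by simp
  qed
  then have La: "norm (L b) \<le> norm (L a)"
    by (intro LIMSEQ_le_const[OF tendsto_norm[OF limL]]) auto
  have "norm (h a) = 1"
  proof (rule ccontr)
    assume "norm (h a) \<noteq> 1"
    with h1[OF aK] obtain q where q: "norm (h a) < q" "q < 1"
      by (metis dense less_eq_real_def)
    have q0: "q > 0" using q(1) norm_ge_zero le_less_trans by blast
    have "eventually (\<lambda>k. norm (h (c (r k))) < q) sequentially"
      using order_tendstoD(2)[OF tendsto_norm[OF limh] q(1)] .
    then have ev: "eventually (\<lambda>k. norm (L b) \<le> q ^ k * norm (L (c (r k)))) sequentially"
    proof eventually_elim
      fix k assume k: "norm (h (c (r k))) < q"
      have "norm (h (c (r k))) ^ r k \<le> q ^ r k" by (intro power_mono) (use k in auto)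
      \<comment> \<open>Here the exponent is the index \<open>r k \<ge> k\<close> of the subsequence.\<close>
      also have "\<dots> \<le> q ^ k"
        by (intro power_decreasing seq_suble r) (use q q0 in auto)
      finally show "norm (L b) \<le> q ^ k * norm (L (c (r k)))"
        using c(2)[of "r k"] by (meson mult_right_mono norm_ge_zero order_trans)
    qed
    have "(\<lambda>k. q ^ k * norm (L (c (r k)))) \<longlonglongrightarrow> 0 * norm (L a)"
      by (intro tendsto_mult tendsto_norm limL LIMSEQ_power_zero) (use q q0 in auto)
    then have "norm (L b) \<le> 0"
      using ev by (intro tendsto_lowerbound[where f = "\<lambda>k. q ^ k * norm (L (c (r k)))" and F = sequentially]) auto
    with Lb show False by simp
  qed
  with La aK a uniq show ?thesis by blast
qed

lemma shilov_boundary_eqI: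
  assumes "max_modulus_set K B" "\<And>C. max_modulus_set K C \<Longrightarrow> B \<subseteq> C"
  shows "shilov_boundary K = B"
  unfolding shilov_boundary_def by (rule Least_equality) (use assms in auto)

lemma norm_one_plus_eq_2:
  assumes "norm v \<le> 1" "norm (1 + v) = 2"
  shows "v = (1::complex)"
proof -
  have "(norm (1 + v))\<^sup>2 = 1 + 2 * Re v + (norm v)\<^sup>2"
    unfolding cmod_power2 by (simp add: power2_eq_square algebra_simps)
  moreover have "(norm v)\<^sup>2 \<le> 1" using assms(1) by (simp add: power_le_one)
  ultimately have "Re v \<ge> 1" using assms(2) by simp
  with complex_Re_le_cmod[of v] assms(1) have "Re v = 1" "norm v = 1" by linarith+
  moreover have "(norm v)\<^sup>2 = (Re v)\<^sup>2 + (Im v)\<^sup>2" by (rule cmod_power2)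
  ultimately have "Im v = 0" by simp
  with \<open>Re v = 1\<close> show ?thesis by (simp add: complex_eq_iff)
qed

lemma prod_norm_eq_1D:
  fixes f :: "'i \<Rightarrow> real"
  assumes "finite J" "\<And>j. j \<in> J \<Longrightarrow> 0 \<le> f j \<and> f j \<le> 1" "prod f J = 1" "j \<in> J"
  shows "f j = 1"
proof -
  have "1 = f j * prod f (J - {j})"
    using assms by (simp add: prod.remove)
  also have "\<dots> \<le> f j * 1"
    using assms by (intro mult_left_mono prod_le_1) auto
  finally show ?thesis using assms(2,4) by force
qed

text \<open>If \<open>z = exp(2\<pi>is)\<close>, then \<open>exp(2\<pi>i\<lfloor>Ns\<rfloor>/N)\<close> is an \<open>N\<close>-th root of unity and tends to \<open>z\<close>. The order
  depends on \<open>k\<close> only, so it is the same for all coordinates of a point of the torus.\<close>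

lemma root_of_unity_approximation:
  assumes "norm z = 1"
  shows "\<exists>u. u \<longlonglongrightarrow> z \<and> (\<forall>k. u k ^ Suc k = (1::complex))"
proof -
  define s where "s = Arg z / (2 * pi)"
  define q where "q k = of_int \<lfloor>real (Suc k) * s\<rfloor> / real (Suc k)" for k
  have "cis (2 * pi * s) = z"
  proof -
    have "z \<noteq> 0" using assms by auto
    with cis_Arg[of z] assms show ?thesis by (simp add: s_def sgn_div_norm)
  qed
  have "q \<longlonglongrightarrow> s"
  proof (rule tendsto_sandwich)
    show "\<forall>\<^sub>F k in sequentially. s - inverse (real (Suc k)) \<le> q k"
    proof (intro always_eventually allI)
      fix k
      have "real (Suc k) * s - 1 \<le> of_int \<lfloor>real (Suc k) * s\<rfloor>" by linarith
      then have "(real (Suc k) * s - 1) / real (Suc k) \<le> q k"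
        unfolding q_def by (rule divide_right_mono) simp
      then show "s - inverse (real (Suc k)) \<le> q k"
        by (simp add: diff_divide_distrib inverse_eq_divide)
    qed
    show "\<forall>\<^sub>F k in sequentially. q k \<le> s"
    proof (intro always_eventually allI)
      fix k
      have "q k \<le> (real (Suc k) * s) / real (Suc k)"
        unfolding q_def by (intro divide_right_mono of_int_floor_le) simp
      then show "q k \<le> s" by simp
    qed
    show "(\<lambda>k. s - inverse (real (Suc k))) \<longlonglongrightarrow> s"
      using tendsto_diff[OF tendsto_const LIMSEQ_inverse_real_of_nat, of s] by simp
  qed auto
  then have "(\<lambda>k. cis (2 * pi * q k)) \<longlonglongrightarrow> cis (2 * pi * s)"
    by (intro tendsto_intros)
  moreover have "cis (2 * pi * q k) ^ Suc k = 1" for k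
  proof -
    have "real (Suc k) * (2 * pi * q k) = 2 * pi * of_int \<lfloor>real (Suc k) * s\<rfloor>"
      by (simp add: q_def field_simps del: of_nat_Suc)
    then have "cis (2 * pi * q k) ^ Suc k = cis (2 * pi * of_int \<lfloor>real (Suc k) * s\<rfloor>)"
      by (simp only: Complex.DeMoivre)
    then show ?thesis by (simp add: cis_multiple_2pi)
  qed
  ultimately show ?thesis
    using \<open>cis (2 * pi * s) = z\<close> by (intro exI[of _ "\<lambda>k. cis (2 * pi * q k)"]) simp
qed

section \<open>The distinguished boundary of the tetrablock\<close>

text \<open>The set to be identified with the distinguished boundary of the tetrablock.\<close>

definition tetrablock_torus :: "(complex ^ 3) set" where
  "tetrablock_torus = {x. x $ 1 = cnj (x $ 2) * x $ 3 \<and> norm (x $ 2) \<le> 1 \<and> norm (x $ 3) = 1}"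

text \<open>For \<open>\<bar>a\<bar> + \<bar>b\<bar> < 1\<close> these discs fill the tetrablock, and their boundaries lie in the
  distinguished boundary.\<close>

definition affine_disc :: "complex \<Rightarrow> complex \<Rightarrow> complex \<Rightarrow> complex ^ 3" where
  "affine_disc a b \<zeta> = vector [a + cnj b * \<zeta>, b + cnj a * \<zeta>, \<zeta>]"

lemma affine_disc_nth [simp]:
  "affine_disc a b \<zeta> $ 1 = a + cnj b * \<zeta>" "affine_disc a b \<zeta> $ 2 = b + cnj a * \<zeta>"
  "affine_disc a b \<zeta> $ 3 = \<zeta>"
  by (simp_all add: affine_disc_def vector_3)

text \<open>With \<open>x, y\<close> the moduli of \<open>z, w\<close> and \<open>u, v\<close> those of the parameters of an affine disc, the
  right-hand side is a lower bound for \<open>\<bar>A\<bar>\<^sup>2 - \<bar>B\<bar>\<^sup>2\<close>, where \<open>A + \<zeta> * B\<close> is the value of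
  \<open>1 - z x\<^sub>1 - w x\<^sub>2 + z w x\<^sub>3\<close> at the point with parameter \<open>\<zeta>\<close> of that disc. For fixed \<open>c = u + v\<close> it is affine in
  \<open>u\<close>, so it is the convex combination of its values at \<open>u = c\<close> and \<open>u = 0\<close>; these are
  \<open>(1 - cx)\<^sup>2 - y\<^sup>2(x - c)\<^sup>2\<close> and its mirror image, which are visibly nonnegative.\<close>

lemma affine_disc_inequality:
  fixes x y u v :: real
  assumes x: "0 \<le> x" "x \<le> 1" and y: "0 \<le> y" "y \<le> 1" and uv: "0 \<le> u" "0 \<le> v" "u + v \<le> 1"
  shows "0 \<le> 1 - x\<^sup>2 * y\<^sup>2 - 2 * v * y * (1 - x\<^sup>2) - 2 * u * x * (1 - y\<^sup>2) + (y\<^sup>2 - x\<^sup>2) * (v\<^sup>2 - u\<^sup>2)"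
    (is "0 \<le> ?R")
proof (cases "u + v = 0")
  case True
  then have "u = 0" "v = 0" using uv by auto
  then show ?thesis using x y by (simp add: mult_le_one power_le_one)
next
  case False
  define c where "c = u + v"
  have c: "0 < c" "c \<le> 1" using False uv by (auto simp: c_def)
  have edge: "0 \<le> (1 - c * s)\<^sup>2 - t\<^sup>2 * (s - c)\<^sup>2" if s: "0 \<le> s" "s \<le> 1" and t: "0 \<le> t" "t \<le> 1" for s t
  proof -
    have "(1 - c * s)\<^sup>2 - (s - c)\<^sup>2 = (1 - s\<^sup>2) * (1 - c\<^sup>2)"
      by (simp add: power2_eq_square algebra_simps)
    moreover have "0 \<le> (1 - s\<^sup>2) * (1 - c\<^sup>2)"
      using s c by (simp add: power_le_one)
    moreover have "t\<^sup>2 * (s - c)\<^sup>2 \<le> 1 * (s - c)\<^sup>2"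
      using t by (intro mult_right_mono) (auto simp: power_le_one)
    ultimately show ?thesis by linarith
  qed
  have "c * ?R = u * ((1 - c * x)\<^sup>2 - y\<^sup>2 * (x - c)\<^sup>2) + v * ((1 - c * y)\<^sup>2 - x\<^sup>2 * (y - c)\<^sup>2)"
    by (simp add: c_def power2_eq_square algebra_simps)
  also have "\<dots> \<ge> 0"
    using edge x y uv by simp
  finally show ?thesis using c by (simp add: zero_le_mult_iff)
qed

text \<open>At the points of an affine disc the defining expression of the tetrablock is \<open>A + \<zeta> * B\<close> with
  \<open>A = 1 - z a - w b\<close> and \<open>B = z w - z cnj b - w cnj a\<close>. Here \<open>A \<noteq> 0\<close>, and \<open>\<bar>B\<bar> \<le> \<bar>A\<bar>\<close> (with equality for
  unimodular \<open>z, w\<close>), so the sum cannot vanish for \<open>\<bar>\<zeta>\<bar> < 1\<close>.\<close>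

lemma affine_disc_in_tetrablock:
  assumes ab: "norm a + norm b < 1" and \<zeta>: "norm \<zeta> < 1"
  shows "affine_disc a b \<zeta> \<in> tetrablock"
  unfolding tetrablock_def
proof (intro CollectI allI impI)
  fix z w :: complex
  assume zw: "norm z \<le> 1 \<and> norm w \<le> 1"
  define A where "A = 1 - z * a - w * b"
  define B where "B = z * w - z * cnj b - w * cnj a"
  have le: "norm (z * a) \<le> norm a" "norm (w * b) \<le> norm b"
    using zw by (auto simp: norm_mult intro!: mult_left_le_one_le)
  have "A \<noteq> 0"
  proof
    assume "A = 0"
    moreover have "z * a + w * b = 1 - A" by (simp add: A_def)
    ultimately have "1 = norm (z * a + w * b)" by simp
    also have "\<dots> \<le> norm (z * a) + norm (w * b)" by (rule norm_triangle_ineq)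
    finally show False using le ab by linarith
  qed
  have "(norm A)\<^sup>2 - (norm B)\<^sup>2 = 1 - (norm z)\<^sup>2 * (norm w)\<^sup>2 - 2 * Re (w * b) * (1 - (norm z)\<^sup>2)
      - 2 * Re (z * a) * (1 - (norm w)\<^sup>2) + ((norm w)\<^sup>2 - (norm z)\<^sup>2) * ((norm b)\<^sup>2 - (norm a)\<^sup>2)"
    unfolding A_def B_def by (simp only: cmod_power2) (simp add: power2_eq_square algebra_simps)
  also have "\<dots> \<ge> 1 - (norm z)\<^sup>2 * (norm w)\<^sup>2 - 2 * (norm b * norm w) * (1 - (norm z)\<^sup>2)
      - 2 * (norm a * norm z) * (1 - (norm w)\<^sup>2) + ((norm w)\<^sup>2 - (norm z)\<^sup>2) * ((norm b)\<^sup>2 - (norm a)\<^sup>2)"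
  proof -
    have "Re (w * b) * (1 - (norm z)\<^sup>2) \<le> norm b * norm w * (1 - (norm z)\<^sup>2)"
      using zw complex_Re_le_cmod[of "w * b"]
      by (intro mult_right_mono) (auto simp: norm_mult power_le_one mult.commute)
    moreover have "Re (z * a) * (1 - (norm w)\<^sup>2) \<le> norm a * norm z * (1 - (norm w)\<^sup>2)"
      using zw complex_Re_le_cmod[of "z * a"]
      by (intro mult_right_mono) (auto simp: norm_mult power_le_one mult.commute)
    ultimately show ?thesis by linarith
  qed
  also have "1 - (norm z)\<^sup>2 * (norm w)\<^sup>2 - 2 * (norm b * norm w) * (1 - (norm z)\<^sup>2)
      - 2 * (norm a * norm z) * (1 - (norm w)\<^sup>2) + ((norm w)\<^sup>2 - (norm z)\<^sup>2) * ((norm b)\<^sup>2 - (norm a)\<^sup>2) \<ge> 0"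
    using affine_disc_inequality[of "norm z" "norm w" "norm a" "norm b"] zw ab by (simp add: mult.assoc)
  finally have "norm B \<le> norm A"
    by (intro power2_le_imp_le[OF _ norm_ge_zero]) simp
  have "norm (\<zeta> * B) < norm A"
  proof -
    have "norm (\<zeta> * B) \<le> norm \<zeta> * norm A"
      using \<open>norm B \<le> norm A\<close> by (simp add: norm_mult mult_left_mono)
    also have "\<dots> < 1 * norm A"
      using \<zeta> \<open>A \<noteq> 0\<close> by (intro mult_strict_right_mono) auto
    finally show ?thesis by simp
  qed
  then have "A + \<zeta> * B \<noteq> 0"
    by (metis add_eq_0_iff norm_minus_cancel less_irrefl)
  then show "1 - z * affine_disc a b \<zeta> $ 1 - w * affine_disc a b \<zeta> $ 2 + z * w * affine_disc a b \<zeta> $ 3 \<noteq> 0"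
    by (simp add: A_def B_def algebra_simps)
qed

text \<open>Eliminating \<open>b\<close> from the equations for the first two coordinates leaves
  \<open>x\<^sub>1 - cnj x\<^sub>2 * x\<^sub>3 = a (1 - \<bar>x\<^sub>3\<bar>\<^sup>2)\<close>, and symmetrically for \<open>b\<close>. The hypothesis is
  \<open>\<bar>a\<bar> + \<bar>b\<bar> < 1\<close> with these values.\<close>

lemma affine_disc_parameters:
  fixes x :: "complex ^ 3"
  assumes "norm (x $ 1 - cnj (x $ 2) * x $ 3) + norm (x $ 2 - cnj (x $ 1) * x $ 3) < 1 - (norm (x $ 3))\<^sup>2"
  shows "\<exists>a b. norm a + norm b < 1 \<and> norm (x $ 3) < 1 \<and> x = affine_disc a b (x $ 3)"
proof -
  define r where "r = 1 - (norm (x $ 3))\<^sup>2"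
  have r: "r > 0" using assms norm_ge_zero unfolding r_def by (smt (verit))
  then have x3: "norm (x $ 3) < 1"
    unfolding r_def by (simp add: power2_less_1_iff abs_square_less_1)
  define a where "a = (x $ 1 - cnj (x $ 2) * x $ 3) / r"
  define b where "b = (x $ 2 - cnj (x $ 1) * x $ 3) / r"
  have "norm a + norm b = (norm (x $ 1 - cnj (x $ 2) * x $ 3) + norm (x $ 2 - cnj (x $ 1) * x $ 3)) / r"
    using r by (simp add: a_def b_def norm_divide add_divide_distrib)
  then have "norm a + norm b < 1"
    using assms r by (simp add: r_def)
  moreover have rc: "complex_of_real r = 1 - x $ 3 * cnj (x $ 3)"
    using complex_norm_square[of "x $ 3"] by (simp add: r_def)
  have "complex_of_real r \<noteq> 0" using r by simp
  have "a + cnj b * x $ 3 = x $ 1 * (1 - x $ 3 * cnj (x $ 3)) / r"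
       "b + cnj a * x $ 3 = x $ 2 * (1 - x $ 3 * cnj (x $ 3)) / r"
    by (simp_all add: a_def b_def add_divide_distrib[symmetric] algebra_simps)
  then have "a + cnj b * x $ 3 = x $ 1" "b + cnj a * x $ 3 = x $ 2"
    using rc \<open>complex_of_real r \<noteq> 0\<close> by simp_all
  then have "x = affine_disc a b (x $ 3)"
    by (simp add: vec_eq_iff forall_3)
  ultimately show ?thesis using x3 by blast
qed

text \<open>For fixed \<open>w\<close> the defining expression is affine in \<open>z\<close>. It has no zero in the closed disc exactly
  when the coefficient of \<open>z\<close> is smaller in modulus than the constant term.\<close>

lemma tetrablock_section_ineq:
  fixes a b c w :: complex
  assumes "\<And>z. norm z \<le> 1 \<Longrightarrow> 1 - z * a - w * b + z * w * c \<noteq> 0"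
  shows "norm (a - w * c) < norm (1 - w * b)"
proof (rule ccontr)
  assume neg: "\<not> norm (a - w * c) < norm (1 - w * b)"
  have "1 - w * b \<noteq> 0" using assms[of 0] by auto
  with neg have ne: "a - w * c \<noteq> 0" by auto
  define z where "z = (1 - w * b) / (a - w * c)"
  have "norm z \<le> 1" using neg ne by (simp add: z_def norm_divide divide_le_eq_1)
  moreover have "z * (a - w * c) = 1 - w * b" using ne by (simp add: z_def)
  then have "1 - z * a - w * b + z * w * c = 0" by (simp add: algebra_simps)
  ultimately show False using assms by blast
qed

text \<open>Squaring the hypothesis for unimodular \<open>w\<close> gives
  \<open>2 Re (w (b - cnj a * c)) < 1 + \<bar>b\<bar>\<^sup>2 - \<bar>a\<bar>\<^sup>2 - \<bar>c\<bar>\<^sup>2\<close>; the best choice of \<open>w\<close> makes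
  \<open>w (b - cnj a * c)\<close> a nonnegative real.\<close>

lemma tetrablock_half_plane_inequality:
  fixes a b c :: complex
  assumes "\<And>w. norm w = 1 \<Longrightarrow> norm (a - w * c) < norm (1 - w * b)"
  shows "2 * norm (b - cnj a * c) < 1 + (norm b)\<^sup>2 - (norm a)\<^sup>2 - (norm c)\<^sup>2"
proof -
  define d where "d = b - cnj a * c"
  obtain w where w: "norm w = 1" "w * d = norm d"
  proof (cases "d = 0")
    case True
    then show ?thesis using that[of 1] by simp
  next
    case False
    have "cnj d / norm d * d = d * cnj d / norm d" by simp
    also have "\<dots> = of_real (norm d) * of_real (norm d) / of_real (norm d)"
      by (simp only: complex_norm_square[symmetric] power2_eq_square of_real_mult)
    also have "\<dots> = norm d" using False by simp
    finally have "cnj d / norm d * d = norm d" .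
    with False show ?thesis by (intro that[of "cnj d / norm d"]) (auto simp: norm_divide)
  qed
  have w2: "(Re w)\<^sup>2 + (Im w)\<^sup>2 = 1"
    using w(1) by (metis cmod_power2 one_power2)
  have "(norm (1 - w * b))\<^sup>2 - (norm (a - w * c))\<^sup>2
      = 1 - (norm a)\<^sup>2 + ((Re w)\<^sup>2 + (Im w)\<^sup>2) * ((norm b)\<^sup>2 - (norm c)\<^sup>2) - 2 * Re (w * d)"
    unfolding d_def by (simp only: cmod_power2) (simp add: power2_eq_square algebra_simps)
  also have "\<dots> = 1 + (norm b)\<^sup>2 - (norm a)\<^sup>2 - (norm c)\<^sup>2 - 2 * norm d"
    unfolding w2 w(2) by simp
  finally show ?thesis
    using assms[OF w(1)] power_strict_mono[of "norm (a - w * c)" "norm (1 - w * b)" 2]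
    unfolding d_def by simp
qed

text \<open>Adding the half-plane inequalities for the sections in \<open>z\<close> and in \<open>w\<close> cancels \<open>\<bar>x\<^sub>1\<bar>\<^sup>2\<close> and \<open>\<bar>x\<^sub>2\<bar>\<^sup>2\<close>
  and yields the inequality; the converse is the parametrization by affine discs. In this form the
  tetrablock is seen to be open.\<close>

lemma tetrablock_eq:
  "tetrablock = {x. norm (x $ 1 - cnj (x $ 2) * x $ 3) + norm (x $ 2 - cnj (x $ 1) * x $ 3)
                    < 1 - (norm (x $ 3))\<^sup>2}"
proof (intro subset_antisym subsetI CollectI)
  fix x assume x: "x \<in> tetrablock"
  have "norm (x $ 1 - w * x $ 3) < norm (1 - w * x $ 2)" if "norm w = 1" for w
    by (rule tetrablock_section_ineq) (use x that in \<open>auto simp: tetrablock_def\<close>)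
  note 1 = tetrablock_half_plane_inequality[OF this]
  have "norm (x $ 2 - w * x $ 3) < norm (1 - w * x $ 1)" if "norm w = 1" for w
  proof (rule tetrablock_section_ineq)
    fix z :: complex assume "norm z \<le> 1"
    then have "1 - w * x $ 1 - z * x $ 2 + w * z * x $ 3 \<noteq> 0"
      using x \<open>norm w = 1\<close> unfolding tetrablock_def by auto
    then show "1 - z * x $ 2 - w * x $ 1 + z * w * x $ 3 \<noteq> 0"
      by (simp add: algebra_simps)
  qed
  note 2 = tetrablock_half_plane_inequality[OF this]
  from 1 2 show "norm (x $ 1 - cnj (x $ 2) * x $ 3) + norm (x $ 2 - cnj (x $ 1) * x $ 3)
                    < 1 - (norm (x $ 3))\<^sup>2"
    by linarith
next
  fix x :: "complex ^ 3"
  assume x: "x \<in> {x. norm (x $ 1 - cnj (x $ 2) * x $ 3) + norm (x $ 2 - cnj (x $ 1) * x $ 3)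
                    < 1 - (norm (x $ 3))\<^sup>2}"
  then obtain a b where "norm a + norm b < 1" "norm (x $ 3) < 1" "x = affine_disc a b (x $ 3)"
    using affine_disc_parameters by blast
  then show "x \<in> tetrablock"
    using affine_disc_in_tetrablock[of a b "x $ 3"] by simp
qed

lemma open_tetrablock: "open tetrablock"
  unfolding tetrablock_eq by (intro open_Collect_less continuous_intros)

lemma tetrablock_bounds:
  assumes "x \<in> tetrablock"
  shows "norm (x $ i) \<le> 1"
proof -
  have nz: "1 - z * x $ 1 - w * x $ 2 + z * w * x $ 3 \<noteq> 0" if "norm z \<le> 1" "norm w \<le> 1" for z w
    using assms that unfolding tetrablock_def by blast
  have "norm (x $ 1 - 0 * x $ 3) < norm (1 - 0 * x $ 2)"
    by (rule tetrablock_section_ineq) (use nz[of _ 0] in auto)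
  moreover have "norm (x $ 2 - 0 * x $ 3) < norm (1 - 0 * x $ 1)"
    by (rule tetrablock_section_ineq) (use nz[of 0] in auto)
  moreover have "norm (x $ 3) < 1"
    using affine_disc_parameters assms unfolding tetrablock_eq by blast
  ultimately show ?thesis
    by (cases i rule: exhaust_3[THEN disjE]) (use exhaust_3[of i] in auto)
qed

lemma closure_tetrablock_bounds:
  assumes "x \<in> closure tetrablock"
  shows "norm (x $ i) \<le> 1"
    and "norm (x $ 1 - cnj (x $ 2) * x $ 3) \<le> 1 - (norm (x $ 3))\<^sup>2"
proof -
  have "closure tetrablock \<subseteq> {x. norm (x $ i) \<le> 1}"
    by (intro closure_minimal closed_Collect_le continuous_intros) (auto intro: tetrablock_bounds)
  then show "norm (x $ i) \<le> 1" using assms by blast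
  have "closure tetrablock \<subseteq> {x. norm (x $ 1 - cnj (x $ 2) * x $ 3) \<le> 1 - (norm (x $ 3))\<^sup>2}"
  proof (intro closure_minimal closed_Collect_le continuous_intros subsetI CollectI)
    fix x assume "x \<in> tetrablock"
    then show "norm (x $ 1 - cnj (x $ 2) * x $ 3) \<le> 1 - (norm (x $ 3))\<^sup>2"
      unfolding tetrablock_eq by (smt (verit) mem_Collect_eq norm_ge_zero)
  qed
  then show "norm (x $ 1 - cnj (x $ 2) * x $ 3) \<le> 1 - (norm (x $ 3))\<^sup>2"
    using assms by blast
qed

lemma compact_closure_tetrablock: "compact (closure tetrablock)"
  by (intro compact_closure[THEN iffD2] bounded_componentwise_cart[where c = 1] tetrablock_bounds)

text \<open>A point of the set is the end point at \<open>r = 1\<close> of a curve in the tetrablock: it is the value of the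
  affine disc with parameters \<open>x\<^sub>1/2, x\<^sub>2/2\<close> at \<open>x\<^sub>3\<close>, and multiplying both parameters and
  the argument by \<open>r < 1\<close> moves it inside.\<close>

lemma tetrablock_torus_subset: "tetrablock_torus \<subseteq> closure tetrablock"
proof
  fix x assume x: "x \<in> tetrablock_torus"
  define \<psi> where "\<psi> r = affine_disc (of_real r * x $ 1 / 2) (of_real r * x $ 2 / 2) (of_real r * x $ 3)" for r :: real
  have x3: "cnj (x $ 3) * x $ 3 = 1"
    using x complex_norm_square[of "x $ 3"] by (simp add: tetrablock_torus_def mult.commute)
  have x1: "x $ 1 = cnj (x $ 2) * x $ 3" and x2: "norm (x $ 2) \<le> 1" and n3: "norm (x $ 3) = 1"
    using x by (auto simp: tetrablock_torus_def)
  then have n1: "norm (x $ 1) \<le> 1" by (simp add: norm_mult)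
  have c1: "cnj (x $ 1) * x $ 3 = x $ 2"
    unfolding x1 using x3 by (simp add: mult.assoc)
  have "\<psi> 1 = x"
  proof -
    have "\<psi> 1 $ 1 = x $ 1"
      by (simp add: \<psi>_def x1[symmetric])
    moreover have "\<psi> 1 $ 2 = x $ 2"
      by (simp add: \<psi>_def c1)
    ultimately show ?thesis by (simp add: vec_eq_iff forall_3) (simp add: \<psi>_def)
  qed
  moreover have "continuous_on UNIV \<psi>"
  proof (rule continuous_on_cartI)
    fix i
    show "continuous_on UNIV (\<lambda>r. \<psi> r $ i)"
      using exhaust_3[of i] by (elim disjE) (auto simp: \<psi>_def intro!: continuous_intros)
  qed
  ultimately have "(\<lambda>k. \<psi> (real k / real (Suc k))) \<longlonglongrightarrow> x"
    using continuous_on_tendsto_compose[OF _ LIMSEQ_n_over_Suc_n, of UNIV \<psi>] by simp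
  moreover have "\<psi> (real k / real (Suc k)) \<in> tetrablock" for k
  proof -
    define r where "r = real k / real (Suc k)"
    have r: "0 \<le> r" "r < 1" by (auto simp: r_def)
    have "norm (of_real r * x $ 1 / 2) + norm (of_real r * x $ 2 / 2) = r * ((norm (x $ 1) + norm (x $ 2)) / 2)"
      using r by (simp add: norm_mult norm_divide field_simps)
    also have "\<dots> \<le> r * 1" using r n1 x2 by (intro mult_left_mono) auto
    finally have "norm (of_real r * x $ 1 / 2) + norm (of_real r * x $ 2 / 2) < 1"
      using r by linarith
    moreover have "norm (of_real r * x $ 3) < 1" using r n3 by (simp add: norm_mult)
    ultimately show ?thesis
      unfolding \<psi>_def r_def by (rule affine_disc_in_tetrablock)
  qed
  ultimately show "x \<in> closure tetrablock"
    unfolding closure_sequential by (intro exI[of _ "\<lambda>k. \<psi> (real k / real (Suc k))"]) simp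
qed

text \<open>For unimodular \<open>\<zeta>\<close> one has \<open>a + cnj b * \<zeta> = cnj (b + cnj a * \<zeta>) * \<zeta>\<close>, and
  \<open>\<bar>b + cnj a * \<zeta>\<bar> \<le> \<bar>a\<bar> + \<bar>b\<bar>\<close>; hence the boundary of an affine disc lies in the set.\<close>

lemma max_modulus_set_tetrablock_torus: "max_modulus_set (closure tetrablock) tetrablock_torus"
proof (rule max_modulus_set_by_discs[where X = tetrablock])
  have "0 \<in> tetrablock" by (simp add: tetrablock_def)
  then show "closure tetrablock \<noteq> {}" by auto
  show "closed tetrablock_torus"
    unfolding tetrablock_torus_def
    by (intro closed_Collect_conj closed_Collect_eq closed_Collect_le continuous_intros)
  fix x assume "x \<in> tetrablock"
  then obtain a b where ab: "norm a + norm b < 1" "norm (x $ 3) < 1" "x = affine_disc a b (x $ 3)"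
    using affine_disc_parameters unfolding tetrablock_eq by blast
  show "\<exists>\<phi>. continuous_on (cball 0 1) \<phi> \<and> (\<forall>i. (\<lambda>\<zeta>. \<phi> \<zeta> $ i) holomorphic_on ball 0 1) \<and>
      \<phi> ` ball 0 1 \<subseteq> interior (closure tetrablock) \<and> \<phi> ` sphere 0 1 \<subseteq> tetrablock_torus \<and> x \<in> \<phi> ` ball 0 1"
  proof (intro exI[of _ "affine_disc a b"] conjI allI)
    show "continuous_on (cball 0 1) (affine_disc a b)"
    proof (rule continuous_on_cartI)
      fix i show "continuous_on (cball 0 1) (\<lambda>\<zeta>. affine_disc a b \<zeta> $ i)"
        using exhaust_3[of i] by (elim disjE) (auto intro!: continuous_intros)
    qed
    fix i show "(\<lambda>\<zeta>. affine_disc a b \<zeta> $ i) holomorphic_on ball 0 1"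
      using exhaust_3[of i] by (elim disjE) (auto intro!: holomorphic_intros)
  next
    have "affine_disc a b ` ball 0 1 \<subseteq> tetrablock"
      using affine_disc_in_tetrablock[OF ab(1)] by auto
    also have "\<dots> \<subseteq> interior (closure tetrablock)"
      by (intro interior_maximal closure_subset open_tetrablock)
    finally show "affine_disc a b ` ball 0 1 \<subseteq> interior (closure tetrablock)" .
    have "affine_disc a b \<zeta> \<in> tetrablock_torus" if "norm \<zeta> = 1" for \<zeta>
    proof -
      have "cnj \<zeta> * \<zeta> = 1"
        using that complex_norm_square[of \<zeta>] by (simp add: mult.commute)
      moreover have "norm (b + cnj a * \<zeta>) \<le> norm b + norm (cnj a * \<zeta>)" by (rule norm_triangle_ineq)
      ultimately show ?thesis
        using that ab(1) by (simp add: tetrablock_torus_def norm_mult algebra_simps)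
    qed
    then show "affine_disc a b ` sphere 0 1 \<subseteq> tetrablock_torus" by auto
    show "x \<in> affine_disc a b ` ball 0 1" using ab by auto
  qed
qed (use compact_closure_tetrablock tetrablock_torus_subset closure_subset in auto)

text \<open>The function \<open>(1 + cnj b\<^sub>3 * x\<^sub>3) / 2\<close> has modulus 1 on the slice \<open>x\<^sub>3 = b\<^sub>3\<close> only. On that slice
  \<open>x\<^sub>1 cnj b\<^sub>3 = cnj x\<^sub>2\<close>, so the polynomial \<open>(x\<^sub>2 - b\<^sub>2)(x\<^sub>1 cnj b\<^sub>3 - cnj b\<^sub>2)\<close> equals \<open>\<bar>x\<^sub>2 - b\<^sub>2\<bar>\<^sup>2 \<le> 4\<close>
  there; subtracting it from 5 gives a function whose modulus has its only maximum at \<open>b\<close>.\<close>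

lemma tetrablock_torus_minimal:
  assumes C: "max_modulus_set (closure tetrablock) C"
  shows "tetrablock_torus \<subseteq> C"
proof
  fix b assume b: "b \<in> tetrablock_torus"
  then have b1: "b $ 1 = cnj (b $ 2) * b $ 3" and b2: "norm (b $ 2) \<le> 1" and n3: "norm (b $ 3) = 1"
    by (auto simp: tetrablock_torus_def)
  have b3: "cnj (b $ 3) * b $ 3 = 1" "b $ 3 * cnj (b $ 3) = 1"
    using n3 complex_norm_square[of "b $ 3"] by (auto simp: mult.commute)
  let ?h = "\<lambda>x :: complex ^ 3. (1 / 2) * (1 + cnj (b $ 3) * x $ 3)"
  let ?L = "\<lambda>x :: complex ^ 3. 5 - (x $ 2 - b $ 2) * (x $ 1 * cnj (b $ 3) - cnj (b $ 2))"
  have Lb: "?L b = 5" by simp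
  show "b \<in> C"
  proof (rule peak_point_in_max_modulus_set[OF compact_closure_tetrablock C, where h = ?h and L = ?L])
    show "b \<in> closure tetrablock" using b tetrablock_torus_subset by blast
    show "continuous_on (closure tetrablock) ?h" "continuous_on (closure tetrablock) ?L"
      by (intro continuous_intros)+
    show "holomorphic_vec_on ?h (interior (closure tetrablock))"
      "holomorphic_vec_on ?L (interior (closure tetrablock))"
      by (intro holomorphic_vec_intros)+
    show "norm (?h b) = 1" using b3 by simp
    show "?L b \<noteq> 0" using Lb by simp
  next
    fix x assume x: "x \<in> closure tetrablock"
    have v: "norm (cnj (b $ 3) * x $ 3) \<le> 1"
      using closure_tetrablock_bounds(1)[OF x, of 3] n3 by (simp add: norm_mult)
    then show "norm (?h x) \<le> 1"
      using norm_triangle_ineq[of 1 "cnj (b $ 3) * x $ 3"] by (simp add: norm_mult)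
    assume hx: "norm (?h x) = 1" and Lx: "norm (?L b) \<le> norm (?L x)"
    have "norm (1 + cnj (b $ 3) * x $ 3) = 2" using hx by (simp add: norm_mult)
    then have "cnj (b $ 3) * x $ 3 = 1" by (rule norm_one_plus_eq_2[OF v])
    then have x3: "x $ 3 = b $ 3"
      using b3 by (metis mult.left_commute mult.right_neutral)
    then have x1: "x $ 1 = cnj (x $ 2) * b $ 3"
      using closure_tetrablock_bounds(2)[OF x] n3 by simp
    then have "x $ 1 * cnj (b $ 3) = cnj (x $ 2)"
      using b3 by (simp add: mult.assoc)
    then have "?L x = 5 - (x $ 2 - b $ 2) * cnj (x $ 2 - b $ 2)" by simp
    also have "\<dots> = of_real (5 - (norm (x $ 2 - b $ 2))\<^sup>2)"
      by (simp only: complex_norm_square of_real_diff) simp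
    finally have "norm (?L x) = \<bar>5 - (norm (x $ 2 - b $ 2))\<^sup>2\<bar>"
      by (simp only: norm_of_real)
    moreover have "norm (x $ 2 - b $ 2) \<le> 2"
      using norm_triangle_ineq4[of "x $ 2" "b $ 2"] closure_tetrablock_bounds(1)[OF x, of 2] b2 by linarith
    then have "(norm (x $ 2 - b $ 2))\<^sup>2 \<le> 2\<^sup>2" by (intro power_mono) auto
    ultimately have "(norm (x $ 2 - b $ 2))\<^sup>2 \<le> 0"
      using Lx unfolding Lb by simp
    then have "x $ 2 = b $ 2" by simp
    then show "x = b" using x1 x3 b1 by (simp add: vec_eq_iff forall_3)
  qed
qed

lemma b_tetrablock_eq: "b_tetrablock = tetrablock_torus"
  unfolding b_tetrablock_def
  by (intro shilov_boundary_eqI max_modulus_set_tetrablock_torus tetrablock_torus_minimal)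

section \<open>The polynomial attached to a point\<close>

locale theta_setting =
  fixes idx :: "nat \<Rightarrow> 'n::finite" and m p :: nat
  assumes m_pos: "0 < m" and p_pos: "0 < p" and p_dvd_m: "p dvd m"
    and idx: "bij_betw idx {1..CARD('n)} UNIV"

begin

lemma card_pos: "CARD('n) > 0" by simp

lemma m_div_p: "m div p > 0" "m div p * p = m"
  using m_pos p_pos p_dvd_m by (auto simp: dvd_imp_le div_greater_zero_iff)

lemma theta_map_nth:
  assumes "i \<in> {1..CARD('n)}"
  shows "theta_map idx m p z $ idx i =
    (if i = CARD('n) then (\<Prod>l\<in>UNIV. z $ l) ^ (m div p) else elem_sym i UNIV (\<lambda>l. (z $ l) ^ m))"
proof -
  have "the_inv_into {1..CARD('n)} idx (idx i) = i"
    using idx assms by (intro the_inv_into_f_f) (auto simp: bij_betw_def)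
  then show ?thesis by (simp add: theta_map_def Let_def)
qed

lemma vec_eq_by_idx:
  assumes "\<And>i. i \<in> {1..CARD('n)} \<Longrightarrow> x $ idx i = y $ idx i"
  shows "x = (y :: complex ^ 'n)"
proof -
  have "x $ j = y $ j" for j
  proof -
    have "j \<in> idx ` {1..CARD('n)}" using idx by (simp add: bij_betw_def)
    then show ?thesis using assms by auto
  qed
  then show ?thesis by (simp add: vec_eq_iff)
qed

text \<open>The elementary symmetric functions of the roots of the polynomial attached to \<open>y\<close>; the value 1 at
  index 0 is its leading coefficient.\<close>

definition root_coeff :: "complex ^ 'n \<Rightarrow> nat \<Rightarrow> complex" where
  "root_coeff y i = (if i = 0 then 1 else if i = CARD('n) then (y $ idx i) ^ p else y $ idx i)"

definition theta_poly :: "complex ^ 'n \<Rightarrow> complex poly" where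
  "theta_poly y = (\<Sum>i\<le>CARD('n). monom ((- 1) ^ i * root_coeff y i) (CARD('n) - i))"

lemma coeff_theta_poly: "i \<le> CARD('n) \<Longrightarrow> coeff (theta_poly y) (CARD('n) - i) = (- 1) ^ i * root_coeff y i"
  unfolding theta_poly_def by (rule coeff_sum_monom_rev)

lemma coeff_theta_poly_card: "coeff (theta_poly y) (CARD('n)) = 1"
  using coeff_theta_poly[of 0 y] by (simp add: root_coeff_def)

lemma degree_theta_poly: "degree (theta_poly y) = CARD('n)"
proof (rule antisym)
  show "degree (theta_poly y) \<le> CARD('n)"
    unfolding theta_poly_def
    by (intro degree_sum_le) (auto intro: order_trans[OF degree_monom_le])
  show "CARD('n) \<le> degree (theta_poly y)"
    using coeff_theta_poly_card by (intro le_degree) simp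
qed

lemma theta_poly_eq_iff:
  "theta_poly y = monic_with_roots UNIV w \<longleftrightarrow> (\<forall>i\<le>CARD('n). root_coeff y i = elem_sym i (UNIV :: 'n set) w)"
  by (subst eq_monic_with_roots_iff) (simp_all add: degree_theta_poly coeff_theta_poly)

lemma theta_poly_splits: "\<exists>w. theta_poly y = monic_with_roots UNIV (w :: 'n \<Rightarrow> complex)"
  by (rule monic_splits) (simp_all add: degree_theta_poly coeff_theta_poly_card)

lemma poly_theta_poly:
  "poly (theta_poly y) x = (\<Sum>i\<le>CARD('n). (- 1) ^ i * root_coeff y i * x ^ (CARD('n) - i))"
  by (simp add: theta_poly_def poly_sum poly_monom)

lemma continuous_on_root_coeff: "continuous_on S (\<lambda>y. root_coeff y i)"
  by (cases "i = 0"; cases "i = CARD('n)") (auto simp: root_coeff_def intro!: continuous_intros)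

lemma holomorphic_root_coeff: "holomorphic_vec_on (\<lambda>y. root_coeff y i) U"
  by (cases "i = 0"; cases "i = CARD('n)") (auto simp: root_coeff_def intro!: holomorphic_vec_intros)

lemma theta_poly_theta_map: "theta_poly (theta_map idx m p z) = monic_with_roots UNIV (\<lambda>l. (z $ l) ^ m)"
  unfolding theta_poly_eq_iff
proof (intro allI impI)
  fix i assume "i \<le> CARD('n)"
  then consider "i = 0" | "i = CARD('n)" | "i \<in> {1..CARD('n)}" "i \<noteq> 0" "i \<noteq> CARD('n)" by fastforce
  then show "root_coeff (theta_map idx m p z) i = elem_sym i UNIV (\<lambda>l. (z $ l) ^ m)"
  proof cases
    case 2
    have "root_coeff (theta_map idx m p z) i = ((\<Prod>l\<in>UNIV. z $ l) ^ (m div p)) ^ p"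
      using theta_map_nth[of "CARD('n)" z] 2 by (simp add: root_coeff_def Suc_le_eq)
    also have "\<dots> = (\<Prod>l\<in>UNIV. (z $ l) ^ m)"
      by (simp add: power_mult[symmetric] m_div_p prod_power_distrib)
    finally show ?thesis using elem_sym_card[of "UNIV :: 'n set" "\<lambda>l. (z $ l) ^ m"] 2 by simp
  qed (use theta_map_nth[of i z] in \<open>auto simp: root_coeff_def elem_sym_0\<close>)
qed

text \<open>Take any \<open>m\<close>-th roots \<open>r\<^sub>l\<close> of the \<open>w\<^sub>l\<close>. Then \<open>(\<Prod>l. r\<^sub>l)\<^bsup>m/p\<^esup>\<close> and \<open>y\<^sub>n\<close> have the same \<open>p\<close>-th power, so they
  differ by a \<open>p\<close>-th root of unity \<open>\<eta>\<close>. Multiplying a single \<open>r\<^sub>l\<close> by \<open>\<zeta>\<close> with \<open>\<zeta>\<^bsup>m/p\<^esup> = \<eta>\<close> repairs the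
  last coordinate and does not change \<open>r\<^sub>l\<^sup>m\<close>, because \<open>\<zeta>\<^sup>m = \<eta>\<^sup>p = 1\<close>.\<close>

lemma theta_map_lift:
  assumes w: "theta_poly y = monic_with_roots UNIV w"
  shows "\<exists>z. theta_map idx m p z = y \<and> (\<forall>l. (z $ l) ^ m = w l)"
proof -
  let ?N = "CARD('n)"
  have e: "root_coeff y i = elem_sym i UNIV w" if "i \<le> ?N" for i
    using w that unfolding theta_poly_eq_iff by blast
  have "\<exists>z. z ^ m = w l" for l
    using m_pos exists_complex_root[of m "w l"] by (metis less_irrefl)
  then obtain r where r: "\<And>l. r l ^ m = w l" by metis
  define P where "P = (\<Prod>l\<in>UNIV. r l) ^ (m div p)"
  have "P ^ p = (\<Prod>l\<in>UNIV. w l)"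
    by (simp add: P_def power_mult[symmetric] m_div_p prod_power_distrib r)
  also have "\<dots> = (y $ idx ?N) ^ p"
    using e[of ?N] elem_sym_card[of "UNIV :: 'n set" w] by (simp add: root_coeff_def)
  finally have P: "P ^ p = (y $ idx ?N) ^ p" .
  obtain \<eta> where \<eta>: "\<eta> ^ p = 1" "\<eta> * P = y $ idx ?N"
  proof (cases "P = 0")
    case True
    then have "y $ idx ?N = 0" using P p_pos by (metis power_eq_0_iff)
    with True that[of 1] show ?thesis by simp
  next
    case False
    have "(y $ idx ?N / P) ^ p = 1" using P False by (simp add: power_divide flip: P)
    with False show ?thesis by (intro that[of "y $ idx ?N / P"]) auto
  qed
  obtain \<zeta> where \<zeta>: "\<zeta> ^ (m div p) = \<eta>"
    using m_div_p(1) exists_complex_root[of "m div p" \<eta>] by (metis less_irrefl)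
  have "\<zeta> ^ m = 1"
    using \<eta>(1) \<zeta> by (metis m_div_p(2) power_mult)
  \<comment> \<open>The coordinate \<open>idx 1\<close> that is modified is an arbitrary choice.\<close>
  define z where "z = (\<chi> l. if l = idx 1 then \<zeta> * r l else r l)"
  have zm: "(z $ l) ^ m = w l" for l
    by (simp add: z_def power_mult_distrib \<open>\<zeta> ^ m = 1\<close> r)
  have "(\<Prod>l\<in>UNIV. z $ l) = \<zeta> * (\<Prod>l\<in>UNIV. r l)"
  proof -
    have "(\<Prod>l\<in>UNIV. z $ l) = (\<zeta> * r (idx 1)) * (\<Prod>l\<in>UNIV - {idx 1}. z $ l)"
      by (subst prod.remove[of _ "idx 1"]) (auto simp: z_def)
    also have "(\<Prod>l\<in>UNIV - {idx 1}. z $ l) = (\<Prod>l\<in>UNIV - {idx 1}. r l)"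
      by (rule prod.cong) (auto simp: z_def)
    finally show ?thesis by (simp add: prod.remove[of UNIV "idx 1" r])
  qed
  then have last: "(\<Prod>l\<in>UNIV. z $ l) ^ (m div p) = y $ idx ?N"
    using \<eta>(2) \<zeta> by (simp add: P_def power_mult_distrib)
  have "theta_map idx m p z = y"
  proof (rule vec_eq_by_idx)
    fix i assume i: "i \<in> {1..?N}"
    show "theta_map idx m p z $ idx i = y $ idx i"
    proof (cases "i = ?N")
      case True
      then show ?thesis using theta_map_nth[OF i, of z] last by simp
    next
      case False
      then show ?thesis
        using theta_map_nth[OF i, of z] e[of i] i by (simp add: zm root_coeff_def)
    qed
  qed
  with zm show ?thesis by blast
qed

section \<open>The distinguished boundary of the image of the polydisc\<close>

lemma continuous_on_theta_map: "continuous_on S (theta_map idx m p)"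
proof (rule continuous_on_cartI)
  fix j
  obtain i where i: "i \<in> {1..CARD('n)}" "j = idx i"
    using idx unfolding bij_betw_def by blast
  show "continuous_on S (\<lambda>z. theta_map idx m p z $ j)"
    unfolding i(2) theta_map_nth[OF i(1)] elem_sym_def
    by (cases "i = CARD('n)") (auto intro!: continuous_intros)
qed

lemma theta_map_holomorphic_along:
  assumes "\<And>l. (\<lambda>\<zeta>. \<phi> \<zeta> $ l) holomorphic_on U"
  shows "(\<lambda>\<zeta>. theta_map idx m p (\<phi> \<zeta>) $ j) holomorphic_on U"
proof -
  obtain i where i: "i \<in> {1..CARD('n)}" "j = idx i"
    using idx unfolding bij_betw_def by blast
  show ?thesis
    unfolding i(2) theta_map_nth[OF i(1)] elem_sym_def
    by (cases "i = CARD('n)") (auto intro!: holomorphic_intros assms)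
qed

definition torus :: "(complex ^ 'n) set" where
  "torus = {z. \<forall>l. norm (z $ l) = 1}"

lemma compact_polydisc: "compact {z :: complex ^ 'n. \<forall>l. z $ l \<in> cball 0 1}"
  unfolding compact_eq_bounded_closed
proof
  show "bounded {z :: complex ^ 'n. \<forall>l. z $ l \<in> cball 0 1}"
    by (rule bounded_componentwise_cart[where c = 1]) auto
  show "closed {z :: complex ^ 'n. \<forall>l. z $ l \<in> cball 0 1}"
    unfolding mem_cball dist_0_norm
    by (intro closed_Collect_all closed_Collect_le continuous_intros)
qed

lemma compact_torus: "compact torus"
  unfolding compact_eq_bounded_closed
proof
  show "bounded torus"
    by (rule bounded_componentwise_cart[where c = 1]) (auto simp: torus_def)
  show "closed torus"
    unfolding torus_def
    by (intro closed_Collect_all closed_Collect_eq continuous_intros)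
qed

lemma compact_closed_Theta: "compact (closed_Theta idx m p)"
  unfolding closed_Theta_def by (intro compact_continuous_image continuous_on_theta_map compact_polydisc)

lemma theta_torus_subset: "theta_map idx m p ` torus \<subseteq> closed_Theta idx m p"
  unfolding closed_Theta_def torus_def by auto

text \<open>The substitution \<open>x = 1/\<xi>\<close> turns the roots with \<open>\<bar>x\<bar> \<ge> 1\<close> into the zeros of the reversed polynomial
  in the closed disc. The complement of the set is thus the projection of a closed set along a
  compact factor.\<close>

lemma open_roots_in_disc: "open {y. \<forall>x. poly (theta_poly y) x = 0 \<longrightarrow> norm x < 1}"
proof -
  let ?R = "\<lambda>\<xi> y. \<Sum>i\<le>CARD('n). (- 1) ^ i * root_coeff y i * \<xi> ^ i"
  have poly_R: "poly (theta_poly y) x = x ^ CARD('n) * ?R (1 / x) y" if "x \<noteq> 0" for x y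
    unfolding theta_poly_def poly_sum poly_monom sum_distrib_left
    by (rule sum.cong) (use that in \<open>auto simp: power_diff power_divide field_simps\<close>)
  have R0: "?R 0 y = 1" for y
  proof -
    have "?R 0 y = (\<Sum>i\<le>CARD('n). if i = 0 then 1 else 0)"
      by (rule sum.cong) (auto simp: root_coeff_def)
    then show ?thesis by simp
  qed
  have "{y. \<exists>\<xi>. \<xi> \<in> cball 0 1 \<and> (\<xi>, y) \<in> {q. ?R (fst q) (snd q) = 0}}
      = - {y. \<forall>x. poly (theta_poly y) x = 0 \<longrightarrow> norm x < 1}" (is "?A = - ?B")
  proof (intro set_eqI iffI)
    fix y assume "y \<in> ?A"
    then obtain \<xi> where \<xi>: "norm \<xi> \<le> 1" "?R \<xi> y = 0" by auto
    then have "\<xi> \<noteq> 0" using R0 by (metis zero_neq_one)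
    then have "poly (theta_poly y) (1 / \<xi>) = 0" "1 \<le> norm (1 / \<xi>)"
      using poly_R[of "1 / \<xi>" y] \<xi> by (auto simp: norm_divide divide_le_eq_1)
    then show "y \<in> - ?B" by fastforce
  next
    fix y assume "y \<in> - ?B"
    then obtain x where x: "poly (theta_poly y) x = 0" "1 \<le> norm x" by force
    then have "x \<noteq> 0" by auto
    then have "?R (1 / x) y = 0" "norm (1 / x) \<le> 1"
      using poly_R[of x y] x by (auto simp: norm_divide divide_le_eq_1)
    then show "y \<in> ?A" by (intro CollectI exI[of _ "1 / x"]) auto
  qed
  moreover have "closed ?A"
  proof (rule closed_compact_projection)
    have "continuous_on UNIV (\<lambda>q. root_coeff (snd q) i)" for i
      by (cases "i = 0"; cases "i = CARD('n)") (auto simp: root_coeff_def intro!: continuous_intros)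
    then show "closed {q. ?R (fst q) (snd q) = 0}"
      by (intro closed_Collect_eq continuous_intros)
  qed simp
  ultimately show ?thesis by (simp add: open_closed)
qed

text \<open>The points whose polynomials have all roots in the open disc form an open neighbourhood that lies in the image of the closed polydisc.\<close>

lemma theta_map_open_polydisc_interior:
  assumes "\<And>l. norm (z $ l) < 1"
  shows "theta_map idx m p z \<in> interior (closed_Theta idx m p)"
proof (rule interiorI[OF open_roots_in_disc])
  have "norm x < 1" if x: "poly (theta_poly (theta_map idx m p z)) x = 0" for x
  proof -
    obtain l where "x = (z $ l) ^ m"
      using x by (auto simp: theta_poly_theta_map poly_monic_with_roots)
    then show ?thesis using assms[of l] m_pos by (simp add: norm_power power_less_one_iff)
  qed
  then show "theta_map idx m p z \<in> {y. \<forall>x. poly (theta_poly y) x = 0 \<longrightarrow> norm x < 1}"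
    by blast
  show "{y. \<forall>x. poly (theta_poly y) x = 0 \<longrightarrow> norm x < 1} \<subseteq> closed_Theta idx m p"
  proof
    fix y assume y: "y \<in> {y. \<forall>x. poly (theta_poly y) x = 0 \<longrightarrow> norm x < 1}"
    obtain w :: "'n \<Rightarrow> complex" where w: "theta_poly y = monic_with_roots UNIV w" using theta_poly_splits by blast
    then obtain v where v: "theta_map idx m p v = y" "\<And>l. (v $ l) ^ m = w l"
      using theta_map_lift by blast
    have "norm (v $ l) \<le> 1" for l
    proof -
      have "poly (theta_poly y) (w l) = 0" by (auto simp: w poly_monic_with_roots)
      then have "norm (w l) < 1" using y by blast
      then have "norm (v $ l) ^ m < 1" by (simp flip: v(2) add: norm_power)
      then show ?thesis using m_pos by (simp add: power_less_one_iff)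
    qed
    then show "y \<in> closed_Theta idx m p"
      unfolding closed_Theta_def using v(1) by auto
  qed
qed

text \<open>Through a point \<open>z\<close> of the open polydisc passes the disc whose coordinates are the Blaschke factors
  \<open>(\<zeta> + z\<^sub>l) / (1 + cnj z\<^sub>l * \<zeta>)\<close>; it maps the unit circle into the torus, and \<open>\<theta>\<close> carries it to
  the required disc.\<close>

lemma max_modulus_set_theta_torus:
  "max_modulus_set (closed_Theta idx m p) (theta_map idx m p ` torus)"
proof (rule max_modulus_set_by_discs[where X = "theta_map idx m p ` {z. \<forall>l. norm (z $ l) < 1}"])
  show "closed (theta_map idx m p ` torus)"
    by (intro compact_imp_closed compact_continuous_image continuous_on_theta_map compact_torus)
  have "0 \<in> {z :: complex ^ 'n. \<forall>l. z $ l \<in> cball 0 1}" by simp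
  then show "closed_Theta idx m p \<noteq> {}" unfolding closed_Theta_def by blast
  show "closed_Theta idx m p \<subseteq> closure (theta_map idx m p ` {z. \<forall>l. norm (z $ l) < 1})"
  proof
    fix y assume "y \<in> closed_Theta idx m p"
    then obtain z where z: "\<And>l. norm (z $ l) \<le> 1" "y = theta_map idx m p z"
      unfolding closed_Theta_def by auto
    define u where "u k = (real k / real (Suc k)) *\<^sub>R z" for k
    have "u \<longlonglongrightarrow> 1 *\<^sub>R z"
      unfolding u_def by (intro tendsto_scaleR LIMSEQ_n_over_Suc_n tendsto_const)
    then have "(\<lambda>k. theta_map idx m p (u k)) \<longlonglongrightarrow> y"
      using continuous_on_tendsto_compose[OF continuous_on_theta_map[of UNIV], of u z] z(2) by simp
    moreover have "norm (u k $ l) < 1" for k l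
    proof -
      have "norm (u k $ l) = real k / real (Suc k) * norm (z $ l)" by (simp add: u_def)
      also have "\<dots> \<le> real k / real (Suc k) * 1" by (intro mult_left_mono z) auto
      also have "\<dots> < 1" by simp
      finally show ?thesis .
    qed
    ultimately show "y \<in> closure (theta_map idx m p ` {z. \<forall>l. norm (z $ l) < 1})"
      unfolding closure_sequential by (intro exI[of _ "\<lambda>k. theta_map idx m p (u k)"]) auto
  qed
  fix y assume "y \<in> theta_map idx m p ` {z. \<forall>l. norm (z $ l) < 1}"
  then obtain z where z: "\<And>l. norm (z $ l) < 1" and y: "y = theta_map idx m p z" by blast
  define \<phi> where "\<phi> \<zeta> = (\<chi> l. (\<zeta> + z $ l) / (1 + cnj (z $ l) * \<zeta>))" for \<zeta>
  have ne: "1 + cnj (z $ l) * \<zeta> \<noteq> 0" if "norm \<zeta> \<le> 1" for \<zeta> l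
  proof
    assume "1 + cnj (z $ l) * \<zeta> = 0"
    then have "norm (cnj (z $ l) * \<zeta>) = 1" by (metis add_eq_0_iff norm_minus_cancel norm_one)
    then have "norm (z $ l) * norm \<zeta> = 1" by (simp add: norm_mult)
    moreover have "norm (z $ l) * norm \<zeta> \<le> norm (z $ l) * 1"
      using that by (intro mult_left_mono) auto
    ultimately show False using z[of l] by simp
  qed
  have id: "(norm (1 + cnj (z $ l) * \<zeta>))\<^sup>2 - (norm (\<zeta> + z $ l))\<^sup>2 = (1 - (norm \<zeta>)\<^sup>2) * (1 - (norm (z $ l))\<^sup>2)"
    for l \<zeta>
    using blaschke_identity[of "- (z $ l)" \<zeta>] by simp
  have in_disc: "norm (\<phi> \<zeta> $ l) < 1" if "norm \<zeta> < 1" for \<zeta> l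
  proof -
    have "(1 - (norm \<zeta>)\<^sup>2) * (1 - (norm (z $ l))\<^sup>2) > 0"
      using that z[of l] by (simp add: abs_square_less_1)
    then have "(norm (\<zeta> + z $ l))\<^sup>2 < (norm (1 + cnj (z $ l) * \<zeta>))\<^sup>2" using id[of l \<zeta>] by linarith
    then have "norm (\<zeta> + z $ l) < norm (1 + cnj (z $ l) * \<zeta>)" by (rule power2_less_imp_less) simp
    then show ?thesis using ne[of \<zeta> l] that by (simp add: \<phi>_def norm_divide)
  qed
  have on_torus: "\<phi> \<zeta> \<in> torus" if "norm \<zeta> = 1" for \<zeta>
  proof -
    have "norm (\<phi> \<zeta> $ l) = 1" for l
    proof -
      have "(norm (\<zeta> + z $ l))\<^sup>2 = (norm (1 + cnj (z $ l) * \<zeta>))\<^sup>2" using id[of l \<zeta>] that by simp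
      then have "norm (\<zeta> + z $ l) = norm (1 + cnj (z $ l) * \<zeta>)" by simp
      then show ?thesis using ne[of \<zeta> l] that by (simp add: \<phi>_def norm_divide)
    qed
    then show ?thesis by (simp add: torus_def)
  qed
  have "continuous_on (cball 0 1) \<phi>"
  proof (rule continuous_on_cartI)
    fix l show "continuous_on (cball 0 1) (\<lambda>\<zeta>. \<phi> \<zeta> $ l)"
      unfolding \<phi>_def using ne by (auto intro!: continuous_intros)
  qed
  moreover have "(\<lambda>\<zeta>. \<phi> \<zeta> $ l) holomorphic_on ball 0 1" for l
    unfolding \<phi>_def using ne by (auto intro!: holomorphic_intros)
  moreover have "\<phi> 0 = z" by (simp add: \<phi>_def vec_eq_iff)
  moreover have "theta_map idx m p \<zeta>' \<in> theta_map idx m p ` torus" if "\<zeta>' \<in> torus" for \<zeta>'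
    using that by blast
  ultimately show "\<exists>\<psi>. continuous_on (cball 0 1) \<psi> \<and> (\<forall>i. (\<lambda>\<zeta>. \<psi> \<zeta> $ i) holomorphic_on ball 0 1) \<and>
      \<psi> ` ball 0 1 \<subseteq> interior (closed_Theta idx m p) \<and> \<psi> ` sphere 0 1 \<subseteq> theta_map idx m p ` torus \<and>
      y \<in> \<psi> ` ball 0 1"
    using in_disc on_torus y
    by (intro exI[of _ "\<lambda>\<zeta>. theta_map idx m p (\<phi> \<zeta>)"] conjI allI)
       (auto intro!: continuous_on_compose2[OF continuous_on_theta_map[of UNIV]]
          theta_map_holomorphic_along theta_map_open_polydisc_interior intro: rev_image_eqI[of 0])
next
  show "theta_map idx m p ` {z. \<forall>l. norm (z $ l) < 1} \<subseteq> closed_Theta idx m p"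
    unfolding closed_Theta_def by (intro image_mono) (auto intro: less_imp_le)
qed (use compact_closed_Theta theta_torus_subset in auto)

text \<open>The function \<open>h = \<Prod>l. (1 + w\<^sub>l\<^sup>L) / 2\<close> of the roots \<open>w\<^sub>l\<close> of the attached polynomial has modulus 1
  only if all \<open>w\<^sub>l\<^sup>L\<close> are 1. Up to sign it is the product of the values of the polynomial at the
  zeros of \<open>x\<^sup>L + 1\<close>, hence a polynomial in the coordinates of the point. The set where its modulus is 1 is
  finite, and a product of coordinate differences separates a given point from the others.\<close>

lemma theta_root_of_unity_in_max_modulus_set:
  assumes C: "max_modulus_set (closed_Theta idx m p) C" and L: "L > 0" and z: "\<And>l. (z $ l) ^ L = 1"
  shows "theta_map idx m p z \<in> C"
proof -
  let ?K = "closed_Theta idx m p" and ?b = "theta_map idx m p z"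
  have "\<exists>a. monom 1 L + 1 = monic_with_roots {..<L} a"
  proof (rule monic_splits)
    have "degree (monom 1 L + 1 :: complex poly) = degree (monom (1::complex) L)"
      using L by (intro degree_add_eq_left) (simp add: degree_monom_eq)
    then show "degree (monom 1 L + 1 :: complex poly) = card {..<L}"
      "lead_coeff (monom 1 L + 1 :: complex poly) = 1"
      using L by (simp_all add: degree_monom_eq)
  qed simp
  then obtain a where a: "monom 1 L + 1 = monic_with_roots {..<L} a" ..
  have a_prod: "(\<Prod>j<L. x - a j) = x ^ L + 1" for x
    using arg_cong[OF a, of "\<lambda>q. poly q x"] by (simp add: poly_monom poly_prod)
  define h where "h y = (1 / 2) ^ CARD('n) * (\<Prod>j<L. poly (theta_poly y) (a j))" for y
  have norm_h: "norm (h (theta_map idx m p v)) = (\<Prod>l\<in>UNIV. norm (1 + ((v $ l) ^ m) ^ L) / 2)" for v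
  proof -
    have "norm (\<Prod>j<L. poly (theta_poly (theta_map idx m p v)) (a j))
        = (\<Prod>j<L. \<Prod>l\<in>UNIV. norm (a j - (v $ l) ^ m))"
      by (simp add: theta_poly_theta_map poly_monic_with_roots prod_norm)
    also have "\<dots> = (\<Prod>l\<in>UNIV. \<Prod>j<L. norm ((v $ l) ^ m - a j))"
      by (subst prod.swap) (simp add: norm_minus_commute)
    also have "\<dots> = (\<Prod>l\<in>UNIV. norm (1 + ((v $ l) ^ m) ^ L))"
      unfolding prod_norm a_prod by (simp add: add.commute)
    finally show ?thesis
      by (simp add: h_def norm_mult norm_power norm_divide prod_dividef power_divide)
  qed
  \<comment> \<open>A finite set containing all points of the image at which \<open>h\<close> has modulus 1.\<close>
  define E where "E = theta_map idx m p ` {v. \<forall>l. v $ l \<in> {x. x ^ (m * L) = 1}}"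
  have "finite E"
    unfolding E_def using m_pos L by (intro finite_imageI finite_vec_components finite_nth_roots) simp
  have "\<exists>j. ?b $ j \<noteq> y $ j" if "y \<noteq> ?b" for y
    using that by (metis vec_eq_iff)
  then obtain c where c: "\<And>y. y \<noteq> ?b \<Longrightarrow> ?b $ c y \<noteq> y $ c y" by metis
  define g where "g y = (\<Prod>y'\<in>E - {?b}. y $ c y' - y' $ c y')" for y
  have gb: "g ?b \<noteq> 0"
    using \<open>finite E\<close> c by (auto simp: g_def)
  have factor: "norm (1 + ((v $ l) ^ m) ^ L) / 2 \<le> 1" if "norm (v $ l) \<le> 1" for v :: "complex ^ 'n" and l
  proof -
    have "norm (1 + ((v $ l) ^ m) ^ L) \<le> 1 + norm (((v $ l) ^ m) ^ L)"
      by (metis norm_triangle_ineq norm_one)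
    also have "norm (((v $ l) ^ m) ^ L) \<le> 1"
      using that by (simp add: norm_power power_le_one)
    finally show ?thesis by simp
  qed
  show ?thesis
  proof (rule peak_point_in_max_modulus_set[OF compact_closed_Theta C, where h = h and L = g])
    show "?b \<in> ?K"
    proof -
      have "norm (z $ l) = 1" for l
        using z[of l] L by (metis norm_one norm_power power_eq_1_iff norm_ge_zero less_numeral_extra(3))
      then show ?thesis using theta_torus_subset by (auto simp: torus_def)
    qed
    show "continuous_on ?K h"
      unfolding h_def poly_theta_poly by (intro continuous_intros continuous_on_root_coeff)
    show "holomorphic_vec_on h (interior ?K)"
      unfolding h_def poly_theta_poly by (intro holomorphic_vec_intros holomorphic_root_coeff)
    show "continuous_on ?K g" unfolding g_def by (intro continuous_intros)
    show "holomorphic_vec_on g (interior ?K)" unfolding g_def by (intro holomorphic_vec_intros)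
    show "norm (h ?b) = 1"
      unfolding norm_h by (simp add: power_mult[symmetric] mult.commute[of m] power_mult z)
    show "g ?b \<noteq> 0" by (rule gb)
  next
    fix y assume "y \<in> ?K"
    then obtain v where v: "\<And>l. norm (v $ l) \<le> 1" "y = theta_map idx m p v"
      unfolding closed_Theta_def by auto
    show "norm (h y) \<le> 1"
      unfolding v(2) norm_h using factor v(1) by (intro prod_le_1) auto
    assume hy: "norm (h y) = 1" and gy: "norm (g ?b) \<le> norm (g y)"
    have "(v $ l) ^ (m * L) = 1" for l
    proof -
      have "norm (1 + ((v $ l) ^ m) ^ L) / 2 = 1"
        by (rule prod_norm_eq_1D[where J = UNIV]) (use factor v hy norm_h in auto)
      then have "((v $ l) ^ m) ^ L = 1"
        using v(1)[of l] by (intro norm_one_plus_eq_2) (auto simp: norm_power power_le_one)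
      then show ?thesis by (simp add: power_mult)
    qed
    then have "y \<in> E" unfolding E_def v(2) by auto
    moreover have "g y \<noteq> 0" using gb gy by auto
    ultimately show "y = ?b"
      using \<open>finite E\<close> unfolding g_def by (auto simp: prod_zero_iff)
  qed
qed

text \<open>Tuples of roots of unity of a common order are dense in the torus, and \<open>C\<close> is closed.\<close>

lemma theta_torus_minimal:
  assumes C: "max_modulus_set (closed_Theta idx m p) C"
  shows "theta_map idx m p ` torus \<subseteq> C"
proof
  fix y assume "y \<in> theta_map idx m p ` torus"
  then obtain z where z: "\<And>l. norm (z $ l) = 1" "y = theta_map idx m p z" by (auto simp: torus_def)
  have "\<exists>u. u \<longlonglongrightarrow> z $ l \<and> (\<forall>k. u k ^ Suc k = 1)" for l
    by (rule root_of_unity_approximation) (rule z(1))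
  then obtain u where u: "\<And>l. u l \<longlonglongrightarrow> z $ l" "\<And>l k. u l k ^ Suc k = 1" by metis
  define w where "w k = (\<chi> l. u l k)" for k
  have "w \<longlonglongrightarrow> z"
    by (rule vec_tendstoI) (simp add: w_def u(1))
  then have "(\<lambda>k. theta_map idx m p (w k)) \<longlonglongrightarrow> y"
    using continuous_on_tendsto_compose[OF continuous_on_theta_map[of UNIV], of w z] z(2) by simp
  moreover have "theta_map idx m p (w k) \<in> C" for k
  proof (rule theta_root_of_unity_in_max_modulus_set[OF C, of "Suc k"])
    show "w k $ l ^ Suc k = 1" for l using u(2)[of l k] by (simp only: w_def vec_lambda_beta)
  qed simp
  moreover have "closed C" using C by (simp only: max_modulus_set_def)
  ultimately show "y \<in> C"
    by (metis closed_sequentially)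
qed

lemma b_Theta_eq: "b_Theta idx m p = theta_map idx m p ` torus"
  unfolding b_Theta_def
  by (intro shilov_boundary_eqI max_modulus_set_theta_torus theta_torus_minimal)

lemma in_b_Theta_iff_roots:
  "y \<in> b_Theta idx m p \<longleftrightarrow> (\<exists>w. (\<forall>l. norm (w l) = 1) \<and> theta_poly y = monic_with_roots (UNIV :: 'n set) w)"
proof
  assume "y \<in> b_Theta idx m p"
  then obtain z where z: "\<And>l. norm (z $ l) = 1" "y = theta_map idx m p z"
    unfolding b_Theta_eq torus_def by auto
  then show "\<exists>w. (\<forall>l. norm (w l) = 1) \<and> theta_poly y = monic_with_roots (UNIV :: 'n set) w"
    by (intro exI[of _ "\<lambda>l. (z $ l) ^ m"]) (simp add: theta_poly_theta_map norm_power)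
next
  assume "\<exists>w. (\<forall>l. norm (w l) = 1) \<and> theta_poly y = monic_with_roots (UNIV :: 'n set) w"
  then obtain w :: "'n \<Rightarrow> complex" where w: "\<And>l. norm (w l) = 1" "theta_poly y = monic_with_roots UNIV w" by blast
  from theta_map_lift[OF w(2)] obtain z where z: "theta_map idx m p z = y" "\<And>l. (z $ l) ^ m = w l" by blast
  have "norm (z $ l) = 1" for l
  proof -
    have "norm (z $ l) ^ m = 1" using z(2)[of l] w(1)[of l] by (metis norm_power)
    then show ?thesis using m_pos power_eq_imp_eq_base[of "norm (z $ l)" m 1] by simp
  qed
  then show "y \<in> b_Theta idx m p"
    unfolding b_Theta_eq torus_def using z(1) by auto
qed

section \<open>Boundary points through critical points\<close>

text \<open>Its roots are the critical points of the attached polynomial, and its coefficients are, up to sign, the numbers \<open>\<gamma>\<^sub>i y\<^sub>i\<close>.\<close>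

definition normalized_deriv :: "complex ^ 'n \<Rightarrow> complex poly" where
  "normalized_deriv y = smult (1 / of_nat CARD('n)) (pderiv (theta_poly y))"

lemma degree_normalized_deriv: "degree (normalized_deriv y) = CARD('n) - 1"
  by (simp add: normalized_deriv_def degree_pderiv degree_theta_poly)

lemma coeff_normalized_deriv:
  assumes "i \<le> CARD('n) - 1"
  shows "coeff (normalized_deriv y) (CARD('n) - 1 - i)
       = (- 1) ^ i * (of_nat (CARD('n) - i) / of_nat CARD('n) * root_coeff y i)"
proof -
  have "Suc (CARD('n) - 1 - i) = CARD('n) - i"
    using assms card_pos by linarith
  then show ?thesis
    using coeff_theta_poly[of i y] assms by (simp add: normalized_deriv_def coeff_pderiv)
qed

lemma normalized_deriv_eq_iff:
  "normalized_deriv y = monic_with_roots {1..CARD('n) - 1} v \<longleftrightarrow>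
    (\<forall>i\<in>{1..CARD('n) - 1}. of_real (real (CARD('n) - i) / real CARD('n)) * y $ idx i
        = elem_sym i {1..CARD('n) - 1} v)"
proof -
  let ?J = "{1..CARD('n) - 1}"
  let ?Q = "\<lambda>i. of_nat (CARD('n) - i) / of_nat CARD('n) * root_coeff y i = elem_sym i ?J v"
  have "normalized_deriv y = monic_with_roots ?J v \<longleftrightarrow>
    (\<forall>i\<le>CARD('n) - 1. coeff (normalized_deriv y) (CARD('n) - 1 - i) = (- 1) ^ i * elem_sym i ?J v)"
    using eq_monic_with_roots_iff[of ?J "normalized_deriv y" v] by (simp add: degree_normalized_deriv)
  also have "\<dots> \<longleftrightarrow> (\<forall>i\<le>CARD('n) - 1. ?Q i)"
    by (rule all_cong1, rule imp_cong[OF refl], subst coeff_normalized_deriv, assumption)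
       (simp only: mult_cancel_left, simp)
  also have "\<dots> \<longleftrightarrow> (\<forall>i\<in>?J. ?Q i)"
  proof (intro iffI ballI allI impI)
    fix i assume all: "\<forall>i\<in>?J. ?Q i" and "i \<le> CARD('n) - 1"
    then consider "i = 0" | "i \<in> ?J" by fastforce
    then show "?Q i"
      by cases (use all elem_sym_0[of ?J v] in \<open>auto simp: root_coeff_def\<close>)
  qed auto
  also have "\<dots> \<longleftrightarrow> (\<forall>i\<in>{1..CARD('n) - 1}. of_real (real (CARD('n) - i) / real CARD('n)) * y $ idx i
        = elem_sym i {1..CARD('n) - 1} v)"
    by (intro ball_cong refl) (auto simp: root_coeff_def)
  finally show ?thesis .
qed

lemma normalized_deriv_splits: "\<exists>v. normalized_deriv y = monic_with_roots {1..CARD('n) - 1} v"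
proof (rule monic_splits)
  show "lead_coeff (normalized_deriv y) = 1"
    using coeff_normalized_deriv[of 0 y] by (simp add: degree_normalized_deriv root_coeff_def)
qed (simp_all add: degree_normalized_deriv)

lemma poly_pderiv_eq_0_iff: "poly (pderiv (theta_poly y)) x = 0 \<longleftrightarrow> poly (normalized_deriv y) x = 0"
  by (simp add: normalized_deriv_def)

text \<open>Roots on the circle give the first two conditions through \<open>elem_sym_unimodular\<close> and
  \<open>norm_elem_sym_le\<close>, and the third one by Gauss--Lucas. Conversely the first two conditions make the
  attached polynomial self-inversive, the third puts its critical points into the closed disc, and
  Cohn's theorem applies.\<close>

lemma unimodular_roots_iff:
  "(\<exists>w. (\<forall>l. norm (w l) = 1) \<and> theta_poly y = monic_with_roots (UNIV :: 'n set) w) \<longleftrightarrow>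
     (\<forall>i\<in>{1..CARD('n) - 1}. y $ idx i = cnj (y $ idx (CARD('n) - i)) * (y $ idx CARD('n)) ^ p
         \<and> norm (y $ idx (CARD('n) - i)) \<le> CARD('n) choose i)
     \<and> norm ((y $ idx CARD('n)) ^ p) = 1
     \<and> (\<lambda>i\<in>{1..CARD('n) - 1}. of_real (real (CARD('n) - i) / real CARD('n)) * y $ idx i)
          \<in> symm_polydisc (CARD('n) - 1)"
  (is "?roots \<longleftrightarrow> ?selfinv \<and> ?last \<and> ?polydisc")
proof
  let ?N = "CARD('n)"
  assume ?roots
  then obtain w :: "'n \<Rightarrow> complex" where w1: "\<And>l. norm (w l) = 1" and w: "theta_poly y = monic_with_roots UNIV w"
    by blast
  have e: "root_coeff y i = elem_sym i UNIV w" if "i \<le> ?N" for i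
    using w that unfolding theta_poly_eq_iff by blast
  have last: "(y $ idx ?N) ^ p = (\<Prod>l\<in>UNIV. w l)"
    using e[of ?N] elem_sym_card[of "UNIV :: 'n set" w] by (simp add: root_coeff_def)
  have mid: "y $ idx i = elem_sym i UNIV w" if "i \<in> {1..?N - 1}" for i
  proof -
    from that have "1 \<le> i" "i \<le> ?N - 1" by auto
    then have "i \<noteq> 0" "i < ?N" by linarith+
    then show ?thesis using e[of i] by (simp add: root_coeff_def)
  qed
  have ?selfinv
  proof (intro ballI conjI)
    fix i assume i: "i \<in> {1..?N - 1}"
    then have ni: "?N - i \<in> {1..?N - 1}" by auto
    from i have "1 \<le> i" "i \<le> ?N - 1" by auto
    then have "i \<le> ?N" by linarith
    have "elem_sym i UNIV w = cnj (elem_sym (?N - i) UNIV w) * (\<Prod>l\<in>UNIV. w l)"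
      by (rule elem_sym_unimodular) (use w1 i in auto)
    then show "y $ idx i = cnj (y $ idx (?N - i)) * (y $ idx ?N) ^ p"
      by (simp only: mid[OF i] mid[OF ni] last)
    have "norm (elem_sym (?N - i) UNIV w) \<le> ?N choose (?N - i)"
      by (rule norm_elem_sym_le) (simp_all add: w1)
    then show "norm (y $ idx (?N - i)) \<le> ?N choose i"
      unfolding mid[OF ni] using binomial_symmetric[OF \<open>i \<le> ?N\<close>] by simp
  qed
  moreover have ?last
    unfolding last by (simp add: prod_norm[symmetric] w1)
  moreover have ?polydisc
  proof -
    obtain v where v: "normalized_deriv y = monic_with_roots {1..?N - 1} v"
      using normalized_deriv_splits by blast
    have "norm (v j) \<le> 1" if "j \<in> {1..?N - 1}" for j
    proof (rule pderiv_roots_in_disc[where J = "UNIV :: 'n set" and w = w])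
      have "poly (normalized_deriv y) (v j) = 0"
        unfolding v poly_monic_with_roots using that by auto
      then show "poly (pderiv (monic_with_roots UNIV w)) (v j) = 0"
        by (simp add: poly_pderiv_eq_0_iff flip: w)
    qed (simp_all add: w1)
    then show ?thesis
      using v unfolding restrict_in_symm_polydisc_iff normalized_deriv_eq_iff by blast
  qed
  ultimately show "?selfinv \<and> ?last \<and> ?polydisc" by blast
next
  let ?N = "CARD('n)"
  define c where "c = (y $ idx ?N) ^ p"
  assume "?selfinv \<and> ?last \<and> ?polydisc"
  then have reflection: "\<And>i. i \<in> {1..?N - 1} \<Longrightarrow> y $ idx i = cnj (y $ idx (?N - i)) * c"
    and c1: "norm c = 1" and poly: ?polydisc
    by (auto simp: c_def)
  from poly obtain v where v1: "\<And>j. j \<in> {1..?N - 1} \<Longrightarrow> norm (v j) \<le> 1"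
    and v: "normalized_deriv y = monic_with_roots {1..?N - 1} v"
    unfolding restrict_in_symm_polydisc_iff normalized_deriv_eq_iff by blast
  have crit: "norm x \<le> 1" if "poly (pderiv (theta_poly y)) x = 0" for x
    using that v1 unfolding poly_pderiv_eq_0_iff v poly_monic_with_roots by auto
  have cc: "cnj c * c = 1"
    using c1 complex_norm_square[of c] by (simp add: mult.commute)
  have coeff_reflection: "root_coeff y i = cnj (root_coeff y (?N - i)) * c" if iN: "i \<le> ?N" for i
  proof -
    consider "i = 0" | "i = ?N" | "i \<in> {1..?N - 1}" using iN by fastforce
    then show ?thesis
    proof cases
      case 3
      then have "1 \<le> i" "i \<le> ?N - 1" by auto
      then have "?N - i \<noteq> 0" "?N - i \<noteq> ?N" "i \<noteq> 0" "i \<noteq> ?N" by linarith+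
      then show ?thesis using reflection[OF 3] by (simp add: root_coeff_def)
    qed (auto simp: root_coeff_def c_def[symmetric] cc)
  qed
  have self: "coeff (theta_poly y) k = ((- 1) ^ ?N * c) * cnj (coeff (theta_poly y) (?N - k))"
    if "k \<le> ?N" for k
  proof -
    have "coeff (theta_poly y) k = (- 1) ^ (?N - k) * root_coeff y (?N - k)"
      using coeff_theta_poly[of "?N - k" y] that by simp
    also have "root_coeff y (?N - k) = cnj (root_coeff y k) * c"
      using coeff_reflection[of "?N - k"] that by simp
    also have "(- 1) ^ (?N - k) * (cnj (root_coeff y k) * c)
        = ((- 1) ^ ?N * c) * cnj ((- 1) ^ k * root_coeff y k)"
    proof -
      have "(- 1 :: complex) ^ (?N - k) = (- 1) ^ ?N * (- 1) ^ k"
        using that by (simp add: power_add[symmetric] minus_one_power_iff)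
      then show ?thesis by simp
    qed
    also have "(- 1) ^ k * root_coeff y k = coeff (theta_poly y) (?N - k)"
      using coeff_theta_poly[OF that, of y] by simp
    finally show ?thesis .
  qed
  obtain w :: "'n \<Rightarrow> complex" where w: "theta_poly y = monic_with_roots UNIV w"
    using theta_poly_splits by blast
  have "norm (w l) = 1" for l
  proof (rule self_inversive_roots_unimodular[OF degree_theta_poly card_pos _ self crit])
    show "norm ((- 1) ^ ?N * c) = 1" by (simp add: norm_mult norm_power c1)
    show "poly (theta_poly y) (w l) = 0" by (auto simp: w poly_monic_with_roots)
  qed
  with w show ?roots by blast
qed

end

theorem proposition2p11:
  fixes m p n :: nat and idx :: "nat \<Rightarrow> 'n::finite" and \<theta> :: "complex ^ 'n"
    and k :: "nat \<Rightarrow> nat" and \<gamma> :: "nat \<Rightarrow> real"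
  assumes "0 < m" and "0 < p" and "p dvd m"
    and "n = CARD('n)" and "2 \<le> n"
    and "bij_betw idx {1..n} UNIV"
    and "\<And>i. i \<in> {1..n-1} \<Longrightarrow> k i = ((n - 1) choose i) + ((n - 1) choose (n - i))"
    and "\<And>i. i \<in> {1..n-1} \<Longrightarrow> \<gamma> i = real (n - i) / real n"
  shows "\<theta> \<in> b_Theta idx m p \<longleftrightarrow>
    (\<forall>i\<in>{1..n-1}. vector [\<theta> $ idx i / of_nat (k i), \<theta> $ idx (n - i) / of_nat (k i),
        (\<theta> $ idx n) ^ p] \<in> b_tetrablock) \<and>
    (\<lambda>i\<in>{1..n-1}. of_real (\<gamma> i) * \<theta> $ idx i) \<in> symm_polydisc (n - 1)"
proof -
  interpret theta_setting idx m p
    by unfold_locales (use assms in auto)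
  have k: "k i = n choose i" "k i > 0" if i: "i \<in> {1..n - 1}" for i
  proof -
    have "(n - 1) choose (n - i) = (n - 1) choose (i - 1)"
      using binomial_symmetric[of "i - 1" "n - 1"] i by auto
    then show "k i = n choose i"
      using assms(7)[OF i] choose_reduce_nat[of n i] i by auto
    then show "k i > 0" using i by auto
  qed
  have scale: "x / of_nat c = cnj (y / of_nat c) * d \<longleftrightarrow> x = cnj y * d"
    "norm (y / of_nat c) \<le> 1 \<longleftrightarrow> norm y \<le> c" if "c > 0" for c :: nat and x y d :: complex
    using that by (simp_all add: field_simps norm_divide)
  have tetra: "vector [\<theta> $ idx i / of_nat (k i), \<theta> $ idx (n - i) / of_nat (k i), (\<theta> $ idx n) ^ p] \<in> b_tetrablock
      \<longleftrightarrow> \<theta> $ idx i = cnj (\<theta> $ idx (n - i)) * (\<theta> $ idx n) ^ p \<and> norm (\<theta> $ idx (n - i)) \<le> n choose i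
        \<and> norm ((\<theta> $ idx n) ^ p) = 1" if i: "i \<in> {1..n - 1}" for i
    unfolding b_tetrablock_eq tetrablock_torus_def mem_Collect_eq vector_3 scale[OF k(2)[OF i]]
    using k(1)[OF i] by simp
  have "(\<lambda>i\<in>{1..n-1}. of_real (\<gamma> i) * \<theta> $ idx i)
      = (\<lambda>i\<in>{1..n-1}. of_real (real (n - i) / real n) * \<theta> $ idx i)"
    by (rule restrict_ext) (simp add: assms(8))
  \<comment> \<open>Each tetrablock condition contains \<open>norm ((\<theta> $ idx n) ^ p) = 1\<close>; there is at least one since \<open>n \<ge> 2\<close>.\<close>
  moreover have "1 \<in> {1..n - 1}" using assms(5) by auto
  ultimately show ?thesis
    unfolding in_b_Theta_iff_roots unimodular_roots_iff assms(4)[symmetric] using tetra by auto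
qed

end
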